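(* Let $k\ge 1$ and let $E\subset\mathbb R^2$ be a compact set. For $x_1,x_2\in E$ let $$(A_\Delta)^{TC_k^{edge}}_{x_1,x_2}(E)=\Big\{\big(\mathrm{Area}(x_1,x_2,x_3),\mathrm{Area}(x_2,x_3,x_4),\dots,\mathrm{Area}(x_k,x_{k+1},x_{k+2})\big): x_3,\dots,x_{k+2}\in E\text{ distinct}\Big\}\subset\mathbb R^k.$$ If $\dim(E)>1$, then there exist $x_1\neq x_2$ in $E$ such that $\mathcal L^k\big((A_\Delta)^{TC_k^{edge}}_{x_1,x_2}(E)\big)>0$.
   Context: $\dim$ is Hausdorff dimension, $\mathcal L^k$ is Lebesgue measure on $\mathbb R^k$, and $\mathrm{Area}(x,y,z)$ is the area of the triangle with vertices $x,y,z$. *)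

theory Defs
  imports "HOL-Analysis.Analysis"
begin

text \<open>
  Conventions: \<open>(diam {})\<^sup>s = 0\<close> for all \<open>s\<close>, and \<open>(diam U)\<^sup>0 = 1\<close> for nonempty \<open>U\<close>.
  The case distinctions are needed because \<open>0 powr 0 = 0\<close>; boundedness of the covering sets is
  required explicitly below because \<^const>\<open>diameter\<close> is \<open>0\<close> on unbounded sets.
\<close>

definition diam_powr :: "real \<Rightarrow> 'a::metric_space set \<Rightarrow> ennreal" where
  "diam_powr s U = (if U = {} then 0 else if s = 0 then 1 else ennreal (diameter U powr s))"

definition hausdorff_content :: "real \<Rightarrow> real \<Rightarrow> 'a::metric_space set \<Rightarrow> ennreal" where
  "hausdorff_content s \<delta> A =
     (INF U \<in> {U :: nat \<Rightarrow> 'a set. A \<subseteq> (\<Union>i. U i) \<and> (\<forall>i. bounded (U i) \<and> diameter (U i) \<le> \<delta>)}.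
        \<Sum>i. diam_powr s (U i))"

definition hausdorff_measure :: "real \<Rightarrow> 'a::metric_space set \<Rightarrow> ennreal" where
  "hausdorff_measure s A = (SUP \<delta> \<in> {0<..}. hausdorff_content s \<delta> A)"

definition hausdorff_dim :: "'a::metric_space set \<Rightarrow> ereal" where
  "hausdorff_dim A = Inf {ereal s | s. 0 \<le> s \<and> hausdorff_measure s A = 0}"

definition triangle_area :: "real^2 \<Rightarrow> real^2 \<Rightarrow> real^2 \<Rightarrow> real" where
  "triangle_area x y z = measure lebesgue (convex hull {x, y, z})"

text \<open>
  Since \<open>k\<close> is a number, \<open>\<real>\<^sup>k\<close> is represented by the extensional functions on \<open>{1..k}\<close>, and
  Lebesgue measure on it is the completion of the \<open>k\<close>-fold product of \<^const>\<open>lborel\<close>.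
\<close>

definition lebesgue_pow :: "nat \<Rightarrow> (nat \<Rightarrow> real) measure" where
  "lebesgue_pow k = completion (Pi\<^sub>M {1..k} (\<lambda>_. lborel))"

text \<open>
  The points \<open>x 3, \<dots>, x (k + 2)\<close> are distinct from one another; they may coincide with
  \<open>x 1\<close> or \<open>x 2\<close>.
\<close>

definition edge_chain_areas :: "nat \<Rightarrow> (real^2) set \<Rightarrow> real^2 \<Rightarrow> real^2 \<Rightarrow> (nat \<Rightarrow> real) set" where
  "edge_chain_areas k E x1 x2 =
     {(\<lambda>j\<in>{1..k}. triangle_area (x j) (x (j + 1)) (x (j + 2))) | x :: nat \<Rightarrow> real^2.
        x 1 = x1 \<and> x 2 = x2 \<and> (\<forall>i\<in>{3..k+2}. x i \<in> E) \<and> inj_on x {3..k+2}}"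

end

theory Submission
  imports Defs
begin

text \<open>
  Let \<open>\<mu>\<close> be a Frostman measure on \<open>E\<close> of some exponent \<open>s > 1\<close>, and let \<open>u\<^sub>a\<close> project the plane
  along the lines of slope parameter \<open>a\<close>. The normalised energies
  \<open>r\<^sup>-\<^sup>2 \<integral> \<mu> {x. z \<le> u\<^sub>a x < z + r}\<^sup>2 dz\<close> increase as \<open>r\<close> is halved, because
  \<open>(s + t)\<^sup>2 \<le> 2 s\<^sup>2 + 2 t\<^sup>2\<close>, and their limit \<open>T a\<close> is locally integrable in \<open>a\<close>, because \<open>\<mu>\<close> has finite
  1-energy. This one function serves twice. If \<open>T a\<close> is finite, the Cauchy-Schwarz inequality shows
  that \<open>u\<^sub>a\<close> maps compact sets of positive \<open>\<mu>\<close>-measure to sets of positive length. And since \<open>T\<close> also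
  dominates the number of pairs \<open>(x, y)\<close> whose direction is close to \<open>a\<close>, the directions of
  \<open>\<mu> \<times> \<mu>\<close>-almost all pairs avoid the null set where \<open>T\<close> is infinite.

  Hence for almost every pair \<open>(x, y)\<close> the areas \<open>Area(x, y, z)\<close>, with \<open>z\<close> in any given compact set of
  positive measure, fill a set of positive length, and Fubini's theorem extends this to chains. The
  points of a chain are kept distinct by drawing them from disjoint compact subsets of \<open>E\<close>.
\<close>

section \<open>Frostman measures\<close>

primrec cell :: "(nat \<Rightarrow> 'a set) \<Rightarrow> 'a set \<Rightarrow> bool list \<Rightarrow> 'a set" where
  "cell B E [] = E"
| "cell B E (d # b) = {x \<in> cell B E b. (x \<in> B (length b)) = d}"

text \<open>The head of a list is the latest decision and its tail the parent node. The
  \<open>False\<close> child occupies the left part of the parent's interval, hence the shift for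
  the \<open>True\<close> child.\<close>

primrec left_end :: "(bool list \<Rightarrow> real) \<Rightarrow> bool list \<Rightarrow> real" where
  "left_end w [] = 0"
| "left_end w (d # b) = left_end w b + (if d then w (False # b) else 0)"

primrec bit_path :: "(bool list \<Rightarrow> real) \<Rightarrow> real \<Rightarrow> nat \<Rightarrow> bool list" where
  "bit_path w t 0 = []"
| "bit_path w t (Suc n) = (t \<ge> left_end w (True # bit_path w t n)) # bit_path w t n"

text \<open>The mass of a cell is divided among its two halves in proportion to their content \<open>c\<close>; as \<open>c\<close> is
  subadditive, the mass then never exceeds \<open>c\<close>. Assigning to the cells nested intervals whose lengths are
  their masses realises the measure as an image of Lebesgue measure.\<close>

primrec flow :: "(bool list \<Rightarrow> real) \<Rightarrow> bool list \<Rightarrow> real" where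
  "flow c [] = c []"
| "flow c (d # b) = flow c b * c (d # b) / (c (True # b) + c (False # b))"

lemma length_bit_path [simp]: "length (bit_path w t n) = n"
  by (induction n) auto

text \<open>The children's intervals partition that of the parent at the left end of the
  \<open>True\<close> child, which is exactly the threshold that \<open>bit_path\<close> tests.
  Half-open intervals make the partition exact.\<close>

lemma bit_path_eq_iff:
  assumes "\<And>b. 0 \<le> w b" "\<And>b. w b = w (True # b) + w (False # b)"
  shows "0 \<le> t \<and> t < w [] \<and> bit_path w t (length b) = b \<longleftrightarrow> left_end w b \<le> t \<and> t < left_end w b + w b"
proof (induction b)
  case (Cons d b)
  have "0 \<le> t \<and> t < w [] \<and> bit_path w t (length (d # b)) = d # b \<longleftrightarrow>
      (0 \<le> t \<and> t < w [] \<and> bit_path w t (length b) = b) \<and> d = (t \<ge> left_end w (True # b))"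
    by auto
  also have "\<dots> \<longleftrightarrow> left_end w (d # b) \<le> t \<and> t < left_end w (d # b) + w (d # b)"
    unfolding Cons.IH using assms(2)[of b] assms(1)[of "True # b"] assms(1)[of "False # b"]
    by (cases d) auto
  finally show ?case .
qed auto

text \<open>By induction the parent's mass is at most its content, hence at most the sum of the
  children's contents. So the factor in front of \<open>c (d # b)\<close> is at most 1.\<close>

lemma flow_bounds:
  assumes "\<And>b. 0 \<le> c b" "\<And>b. c b \<le> c (True # b) + c (False # b)"
  shows "0 \<le> flow c b \<and> flow c b \<le> c b"
proof (induction b)
  case (Cons d b)
  let ?s = "c (True # b) + c (False # b)"
  have s: "0 \<le> ?s" "flow c b \<le> ?s" using assms(1)[of "True # b"] assms(1)[of "False # b"]
    assms(2)[of b] Cons.IH by linarith+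
  show ?case
  proof (cases "?s = 0")
    case False
    then have "flow c b / ?s \<le> 1" using s by (simp add: divide_le_eq)
    then have "(flow c b / ?s) * c (d # b) \<le> 1 * c (d # b)"
      by (intro mult_right_mono assms(1))
    then show ?thesis using Cons.IH s assms(1)[of "d # b"]
      by (auto simp: mult.commute mult.left_commute)
  \<comment> \<open>If both children have content 0, division by zero assigns them mass 0.\<close>
  qed (use assms(1) in auto)
qed (use assms in auto)

lemma flow_split:
  assumes "\<And>b. 0 \<le> c b" "\<And>b. c b \<le> c (True # b) + c (False # b)"
  shows "flow c b = flow c (True # b) + flow c (False # b)"
proof (cases "c (True # b) + c (False # b) = 0")
  case True
  \<comment> \<open>Both children have mass 0 here, so no mass may be left at the parent;
    subadditivity forces its content to vanish.\<close>
  then have "flow c b = 0" using flow_bounds[of c b, OF assms] assms(2)[of b] by linarith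
  then show ?thesis by simp
next
  case False
  then show ?thesis by (simp add: add_divide_distrib[symmetric] distrib_left[symmetric])
qed

lemma finite_lists_of_length: "finite {b :: bool list. length b = n \<and> Q b}"
  by (rule finite_subset[OF _ finite_lists_length_eq[of UNIV n]]) auto

text \<open>The measure is the image of Lebesgue measure on \<open>{0..<c E}\<close> under the map
  that follows the address of \<open>t\<close> down the tree to a limit point. Points sent into a
  ball have addresses of depth \<open>n\<close> whose cells come within \<open>\<epsilon> n\<close>
  of it, and each such cell carries at most its content.\<close>

lemma mass_distribution:
  fixes E :: "'a::polish_space set"
  assumes E: "compact E"
    and c: "\<And>A. 0 \<le> c A" "c {} = 0" "c E > 0"
    and sub: "\<And>A A'. A \<subseteq> E \<Longrightarrow> A' \<subseteq> E \<Longrightarrow> c (A \<union> A') \<le> c A + c A'"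
    and diam: "\<And>b x y. x \<in> cell B E b \<Longrightarrow> y \<in> cell B E b \<Longrightarrow> dist x y \<le> \<epsilon> (length b)"
    and lim: "\<epsilon> \<longlonglongrightarrow> 0"
  obtains \<mu> :: "'a measure" where "sets \<mu> = sets borel" "finite_measure \<mu>"
    "emeasure \<mu> (- E) = 0" "emeasure \<mu> UNIV > 0"
    "\<And>x \<rho> n. measure \<mu> (cball x \<rho>) \<le>
       (\<Sum>b | length b = n \<and> (\<exists>y\<in>cell B E b. dist x y \<le> \<rho> + \<epsilon> n). c (cell B E b))"
proof -
  have cell_sub: "cell B E b \<subseteq> E" for b by (induction b) auto
  define g where "g b = c (cell B E b)" for b
  have g0: "0 \<le> g b" for b by (simp add: g_def c)
  have gs: "g b \<le> g (True # b) + g (False # b)" for b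
  proof -
    have "c (cell B E b) = c (cell B E (True # b) \<union> cell B E (False # b))"
      by (rule arg_cong[of _ _ c]) auto
    also have "\<dots> \<le> c (cell B E (True # b)) + c (cell B E (False # b))"
      by (rule sub[OF cell_sub cell_sub])
    finally show ?thesis unfolding g_def .
  qed
  define w where "w = flow g"
  have w0: "0 \<le> w b" and wg: "w b \<le> g b" for b
    using flow_bounds[of g b, OF g0 gs] by (auto simp: w_def)
  have ws: "w b = w (True # b) + w (False # b)" for b
    unfolding w_def by (rule flow_split[OF g0 gs])
  have w_Nil: "w [] = c E" by (simp add: w_def g_def)
  define I where "I b = {left_end w b ..< left_end w b + w b}" for b
  have I_iff: "t \<in> I b \<longleftrightarrow> t \<in> {0..<c E} \<and> bit_path w t (length b) = b" for t b
    using bit_path_eq_iff[of w t b, OF w0 ws] by (auto simp: I_def w_Nil)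
  \<comment> \<open>The cells need not be closed, so nested cells may have empty intersection.
    Arbitrary representatives are chosen, and their limit is caught by the compact set
    \<open>E\<close>.\<close>
  define pt where "pt b = (SOME x. x \<in> cell B E b)" for b
  have pt: "pt (bit_path w t n) \<in> cell B E (bit_path w t n)" if "t \<in> {0..<c E}" for t n
  proof -
    have "t \<in> I (bit_path w t n)" using that I_iff by simp
    \<comment> \<open>An interval that contains \<open>t\<close> has positive length, so the cell
      has positive content and cannot be empty.\<close>
    then have "g (bit_path w t n) > 0" using wg[of "bit_path w t n"] by (auto simp: I_def)
    then have "cell B E (bit_path w t n) \<noteq> {}" using c by (auto simp: g_def)
    then show ?thesis unfolding pt_def using some_in_eq by blast
  qed
  have mono: "cell B E (bit_path w t (n + k)) \<subseteq> cell B E (bit_path w t n)" for t n k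
    by (induction k) auto
  have dist_pt: "dist (pt (bit_path w t m)) (pt (bit_path w t n)) \<le> \<epsilon> n"
    if t: "t \<in> {0..<c E}" and nm: "n \<le> m" for t m n
  proof -
    obtain k where k: "m = n + k" using le_Suc_ex[OF nm] by auto
    have "pt (bit_path w t m) \<in> cell B E (bit_path w t n)"
      unfolding k by (rule subsetD[OF mono pt[OF t]])
    then show ?thesis using diam[OF _ pt[OF t], of _ n] by simp
  qed
  define f where "f t = lim (\<lambda>n. pt (bit_path w t n))" for t
  have conv: "(\<lambda>n. pt (bit_path w t n)) \<longlonglongrightarrow> f t" if t: "t \<in> {0..<c E}" for t
  proof -
    have "Cauchy (\<lambda>n. pt (bit_path w t n))"
    proof (rule metric_CauchyI)
      fix e :: real assume "e > 0"
      then obtain N where N: "\<And>n. n \<ge> N \<Longrightarrow> \<epsilon> n < e / 2" using lim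
        by (metis LIMSEQ_D abs_less_iff diff_zero half_gt_zero real_norm_def)
      show "\<exists>M. \<forall>m\<ge>M. \<forall>n\<ge>M. dist (pt (bit_path w t m)) (pt (bit_path w t n)) < e"
      proof (intro exI allI impI)
        fix m n assume "N \<le> m" "N \<le> n"
        then have "dist (pt (bit_path w t m)) (pt (bit_path w t N)) < e/2"
          "dist (pt (bit_path w t n)) (pt (bit_path w t N)) < e/2"
          using dist_pt[OF t] N[of N] by (meson le_less_trans order_refl)+
        then show "dist (pt (bit_path w t m)) (pt (bit_path w t n)) < e" by (rule dist_triangle_half_l)
      qed
    qed
    then show ?thesis unfolding f_def using Cauchy_convergent convergent_LIMSEQ_iff by blast
  qed
  have fE: "f t \<in> E" if t: "t \<in> {0..<c E}" for t
    by (rule Lim_in_closed_set[OF compact_imp_closed[OF E] _ _ conv[OF t]])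
      (use pt[OF t] cell_sub in \<open>auto simp: eventually_sequentially\<close>)
  have f_near: "dist (f t) (pt (bit_path w t n)) \<le> \<epsilon> n" if t: "t \<in> {0..<c E}" for t n
  proof (rule Lim_bounded)
    show "(\<lambda>m. dist (pt (bit_path w t m)) (pt (bit_path w t n))) \<longlonglongrightarrow> dist (f t) (pt (bit_path w t n))"
      by (intro tendsto_intros conv[OF t])
    show "\<forall>m\<ge>n. dist (pt (bit_path w t m)) (pt (bit_path w t n)) \<le> \<epsilon> n" using dist_pt[OF t] by blast
  qed
  define M where "M = restrict_space (lborel :: real measure) {0..<c E}"
  have space_M: "space M = {0..<c E}" by (simp add: M_def space_restrict_space)
  have sets_M: "A \<in> sets M \<longleftrightarrow> A \<in> sets borel \<and> A \<subseteq> {0..<c E}" for A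
    by (subst M_def, subst sets_restrict_space_iff) auto
  have em_M: "emeasure M A = emeasure lborel A" if "A \<subseteq> {0..<c E}" for A
    using that by (simp add: M_def emeasure_restrict_space)
  have I_sub: "I b \<subseteq> {0..<c E}" for b by (rule subsetI) (simp add: I_iff)
  have I_M: "I b \<in> sets M" for b unfolding sets_M using I_sub by (simp add: I_def)
  interpret M: finite_measure M
    by standard (use c(3) in \<open>simp add: space_M em_M\<close>)
  have [measurable]: "(\<lambda>t. pt (bit_path w t n)) \<in> borel_measurable M" for n
  proof (rule measurableI)
    fix A :: "'a set"
    \<comment> \<open>At each depth there are finitely many representatives, each attained on an
      interval.\<close>
    have "(\<lambda>t. pt (bit_path w t n)) -` A \<inter> space M = (\<Union>b \<in> {b. length b = n \<and> pt b \<in> A}. I b)"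
      by (auto simp: space_M I_iff)
    also have "\<dots> \<in> sets M"
      by (intro sets.finite_UN finite_lists_of_length I_M)
    finally show "(\<lambda>t. pt (bit_path w t n)) -` A \<inter> space M \<in> sets M" .
  qed auto
  have [measurable]: "f \<in> borel_measurable M"
    by (rule borel_measurable_LIMSEQ_metric[of "\<lambda>n t. pt (bit_path w t n)"]) (auto simp: conv space_M)
  define \<mu> where "\<mu> = distr M borel f"
  interpret \<mu>: finite_measure \<mu> unfolding \<mu>_def by (rule M.finite_measure_distr) simp
  show ?thesis
  proof
    show "sets \<mu> = sets borel" by (simp add: \<mu>_def)
    show "finite_measure \<mu>" by (rule \<mu>.finite_measure_axioms)
    have "f -` (- E) \<inter> space M = {}" using fE by (auto simp: space_M)
    then show "emeasure \<mu> (- E) = 0"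
      unfolding \<mu>_def by (subst emeasure_distr) (use compact_imp_closed[OF E] in \<open>auto simp: open_Compl\<close>)
    show "emeasure \<mu> UNIV > 0"
      unfolding \<mu>_def by (subst emeasure_distr) (use c(3) in \<open>auto simp: space_M em_M\<close>)
    fix x \<rho> n
    let ?S = "{b. length b = n \<and> (\<exists>y\<in>cell B E b. dist x y \<le> \<rho> + \<epsilon> n)}"
    have "emeasure \<mu> (cball x \<rho>) = emeasure M (f -` cball x \<rho> \<inter> space M)"
      unfolding \<mu>_def by (subst emeasure_distr) auto
    also have "\<dots> \<le> emeasure M (\<Union>b\<in>?S. I b)"
    proof (rule emeasure_mono)
      show "f -` cball x \<rho> \<inter> space M \<subseteq> (\<Union>b\<in>?S. I b)"
      proof
        fix t assume "t \<in> f -` cball x \<rho> \<inter> space M"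
        then have t: "t \<in> {0..<c E}" "dist x (f t) \<le> \<rho>" by (auto simp: space_M)
        have "dist x (pt (bit_path w t n)) \<le> \<rho> + \<epsilon> n"
          using dist_triangle[of x "pt (bit_path w t n)" "f t"] f_near[OF t(1), of n] t(2) by linarith
        then show "t \<in> (\<Union>b\<in>?S. I b)"
          using pt[OF t(1), of n] t(1) by (auto simp: I_iff intro!: exI[of _ "bit_path w t n"])
      qed
      show "(\<Union>b\<in>?S. I b) \<in> sets M"
        by (intro sets.finite_UN finite_lists_of_length I_M)
    qed
    also have "\<dots> \<le> (\<Sum>b\<in>?S. emeasure M (I b))"
      by (intro emeasure_subadditive_finite finite_lists_of_length) (auto simp: I_M)
    also have "\<dots> = (\<Sum>b\<in>?S. ennreal (w b))"
    proof (rule sum.cong)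
      fix b show "emeasure M (I b) = ennreal (w b)"
        using w0[of b] by (subst em_M[OF I_sub]) (simp add: I_def)
    qed simp
    also have "\<dots> \<le> (\<Sum>b\<in>?S. ennreal (g b))"
      by (intro sum_mono ennreal_leI wg)
    also have "\<dots> = ennreal (\<Sum>b\<in>?S. g b)" by (intro sum_ennreal g0)
    finally show "measure \<mu> (cball x \<rho>) \<le> (\<Sum>b\<in>?S. c (cell B E b))"
      unfolding \<mu>.emeasure_eq_measure g_def by (simp add: sum_nonneg c)
  qed
qed

section \<open>Hausdorff content and its subadditivity\<close>

lemma hausdorff_content_le_cover:
  assumes "A \<subseteq> (\<Union>i. U i)" "\<And>i. bounded (U i) \<and> diameter (U i) \<le> \<delta>"
  shows "hausdorff_content s \<delta> A \<le> (\<Sum>i. diam_powr s (U i))"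
  unfolding hausdorff_content_def using assms by (intro INF_lower) auto

lemma hausdorff_content_mono: "A \<subseteq> A' \<Longrightarrow> hausdorff_content s \<delta> A \<le> hausdorff_content s \<delta> A'"
  unfolding hausdorff_content_def by (rule INF_superset_mono) auto

text \<open>Nearly optimal covers of the two sets are interleaved into a single sequence, and its
  series is regrouped in consecutive pairs.\<close>

lemma hausdorff_content_Un:
  "hausdorff_content s \<delta> (A \<union> A') \<le> hausdorff_content s \<delta> A + hausdorff_content s \<delta> A'"
proof -
  let ?C = "\<lambda>A. {U :: nat \<Rightarrow> 'a set. A \<subseteq> (\<Union>i. U i) \<and> (\<forall>i. bounded (U i) \<and> diameter (U i) \<le> \<delta>)}"
  have *: "hausdorff_content s \<delta> (A \<union> A') \<le> (\<Sum>i. diam_powr s (U i)) + (\<Sum>i. diam_powr s (V i))"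
    if U: "U \<in> ?C A" and V: "V \<in> ?C A'" for U V
  proof -
    define W where "W n = (if even n then U (n div 2) else V (n div 2))" for n
    have W: "W (2 * i) = U i" "W (2 * i + 1) = V i" for i by (auto simp: W_def)
    have "A \<union> A' \<subseteq> (\<Union>i. W i)"
      using U V W by (blast dest: subsetD)
    moreover have "bounded (W i) \<and> diameter (W i) \<le> \<delta>" for i
      using U V by (auto simp: W_def)
    ultimately have "hausdorff_content s \<delta> (A \<union> A') \<le> (\<Sum>i. diam_powr s (W i))"
      by (rule hausdorff_content_le_cover)
    also have "(\<Sum>i. diam_powr s (W i)) = (\<Sum>i. \<Sum>n\<in>{i * 2..<i * 2 + 2}. diam_powr s (W n))"
      by (rule sums_unique, rule sums_group[OF summable_sums]) auto
    also have "\<dots> = (\<Sum>i. diam_powr s (U i) + diam_powr s (V i))"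
    proof (rule suminf_cong)
      fix i :: nat
      have "{i * 2..<i * 2 + 2} = {2 * i, 2 * i + 1}" by auto
      then show "(\<Sum>n\<in>{i * 2..<i * 2 + 2}. diam_powr s (W n)) = diam_powr s (U i) + diam_powr s (V i)"
        using W[of i] by simp
    qed
    also have "\<dots> = (\<Sum>i. diam_powr s (U i)) + (\<Sum>i. diam_powr s (V i))"
      by (rule suminf_add[symmetric]) auto
    finally show ?thesis .
  qed
  show ?thesis
  proof (rule ennreal_le_epsilon)
    fix e :: real
    assume fin: "hausdorff_content s \<delta> A + hausdorff_content s \<delta> A' < top" and e: "0 < e"
    have half: "\<exists>U\<in>?C X. (\<Sum>i. diam_powr s (U i)) < hausdorff_content s \<delta> X + ennreal (e / 2)"
      if "hausdorff_content s \<delta> X < top" for X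
    proof -
      have "hausdorff_content s \<delta> X < hausdorff_content s \<delta> X + ennreal (e / 2)"
        using that e ennreal_add_left_cancel_less[of "hausdorff_content s \<delta> X" 0 "ennreal (e / 2)"] by simp
      then show ?thesis by (subst (asm) (1) hausdorff_content_def) (simp only: INF_less_iff)
    qed
    obtain U V where U: "U \<in> ?C A" "(\<Sum>i. diam_powr s (U i)) < hausdorff_content s \<delta> A + ennreal (e / 2)"
      and V: "V \<in> ?C A'" "(\<Sum>i. diam_powr s (V i)) < hausdorff_content s \<delta> A' + ennreal (e / 2)"
      using half[of A] half[of A'] fin by (auto simp: top.not_eq_extremum[symmetric])
    have "hausdorff_content s \<delta> (A \<union> A') \<le>
        (hausdorff_content s \<delta> A + ennreal (e / 2)) + (hausdorff_content s \<delta> A' + ennreal (e / 2))"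
      using *[OF U(1) V(1)] U(2) V(2) by (meson add_mono less_imp_le order_trans)
    also have "\<dots> = hausdorff_content s \<delta> A + hausdorff_content s \<delta> A' + (ennreal (e / 2) + ennreal (e / 2))"
      by (simp only: ac_simps)
    also have "ennreal (e / 2) + ennreal (e / 2) = ennreal e"
      using e by (subst ennreal_plus[symmetric]) auto
    finally show "hausdorff_content s \<delta> (A \<union> A') \<le>
        hausdorff_content s \<delta> A + hausdorff_content s \<delta> A' + ennreal e" .
  qed
qed

lemma hausdorff_content_le_diameter:
  assumes "bounded A" "diameter A \<le> \<delta>" "0 \<le> \<delta>" "s > 0"
  shows "hausdorff_content s \<delta> A \<le> ennreal (diameter A powr s)"
proof -
  \<comment> \<open>The set covers itself; padding with empty sets costs nothing, as
    \<open>diam_powr\<close> vanishes there.\<close>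
  define U where "U i = (if i = 0 then A else {})" for i :: nat
  have "hausdorff_content s \<delta> A \<le> (\<Sum>i. diam_powr s (U i))"
    using assms by (intro hausdorff_content_le_cover) (auto simp: U_def)
  also have "\<dots> = (\<Sum>i\<in>{0}. diam_powr s (U i))"
    by (rule suminf_finite) (auto simp: U_def diam_powr_def)
  also have "\<dots> \<le> ennreal (diameter A powr s)"
    using assms by (auto simp: U_def diam_powr_def)
  finally show ?thesis .
qed

lemma hausdorff_content_finite_UN:
  assumes "finite F" "\<And>x. x \<in> F \<Longrightarrow> hausdorff_content s \<delta> (A x) = 0" "0 \<le> \<delta>" "s > 0"
  shows "hausdorff_content s \<delta> (\<Union>x\<in>F. A x) = 0"
  using assms(1,2)
proof (induction F)
  case empty
  then show ?case using hausdorff_content_le_diameter[of "{}" \<delta> s] assms by simp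
next
  case (insert x F)
  then show ?case using hausdorff_content_Un[of s \<delta> "A x" "\<Union>x\<in>F. A x"] by simp
qed

text \<open>On sets of diameter less than 1 the parities of \<open>\<lfloor>2\<^sup>i x\<rfloor>\<close> for \<open>i \<le> j\<close> determine \<open>\<lfloor>2\<^sup>j x\<rfloor>\<close>, so the
  cells of even depth are pieces of dyadic squares.\<close>

definition bit_set :: "nat \<Rightarrow> (real^2) set" where
  "bit_set n = {x. odd \<lfloor>2 ^ (n div 2) * (if even n then x $ 1 else x $ 2)\<rfloor>}"

lemma cell_bits:
  "x \<in> cell B E b \<Longrightarrow> y \<in> cell B E b \<Longrightarrow> n < length b \<Longrightarrow> x \<in> B n \<longleftrightarrow> y \<in> B n"
  by (induction b) (auto simp: less_Suc_eq)

lemma cell_inj: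
  assumes "x \<in> cell B E b" "y \<in> cell B E b'" "length b = length b'"
    "\<And>n. n < length b \<Longrightarrow> x \<in> B n \<longleftrightarrow> y \<in> B n"
  shows "b = b'"
  using assms(3,1,2,4) by (induction b b' rule: list_induct2) auto

text \<open>At scale 1 the floors differ by at most 1, so equal parity makes them equal. Once the
  floors at one scale agree, doubling leaves two consecutive candidates, which the next parity
  separates.\<close>

lemma floor_eq_of_parities:
  fixes z z' :: real
  assumes "\<bar>z - z'\<bar> < 1" "\<And>i. i \<le> j \<Longrightarrow> odd \<lfloor>2 ^ i * z\<rfloor> \<longleftrightarrow> odd \<lfloor>2 ^ i * z'\<rfloor>"
  shows "\<lfloor>2 ^ j * z\<rfloor> = \<lfloor>2 ^ j * z'\<rfloor>"
  using assms(2)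
proof (induction j)
  case 0
  have "\<bar>\<lfloor>z\<rfloor> - \<lfloor>z'\<rfloor>\<bar> \<le> 1" using assms(1) by linarith
  moreover have "odd \<lfloor>z\<rfloor> \<longleftrightarrow> odd \<lfloor>z'\<rfloor>" using 0[of 0] by simp
  ultimately show ?case by simp presburger
next
  case (Suc j)
  have 1: "\<lfloor>2 ^ j * z\<rfloor> = \<lfloor>2 ^ j * z'\<rfloor>" using Suc by simp
  have 2: "2 * \<lfloor>t\<rfloor> \<le> \<lfloor>2 * t\<rfloor>" "\<lfloor>2 * t\<rfloor> \<le> 2 * \<lfloor>t\<rfloor> + 1" for t :: real by linarith+
  show ?case using 2[of "2 ^ j * z"] 2[of "2 ^ j * z'"] 1 Suc.prems[of "Suc j"]
    by (simp add: mult.assoc) presburger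
qed

text \<open>The floor at a fine scale determines all coarser ones, so one pair of floors recovers
  all the bits of a cell.\<close>

lemma floor_pow2_div:
  fixes z :: real
  assumes "i \<le> j"
  shows "\<lfloor>2 ^ i * z\<rfloor> = \<lfloor>2 ^ j * z\<rfloor> div 2 ^ (j - i)"
proof -
  have "2 ^ i * z = (2 ^ j * z) / real_of_int (2 ^ (j - i))"
    using assms by (simp add: field_simps power_add[symmetric])
  then show ?thesis using floor_divide_real_eq_div[of "2 ^ (j - i)" "2 ^ j * z"] by simp
qed

lemma dist_vec2_le:
  fixes x y :: "real^2"
  assumes "\<bar>x $ 1 - y $ 1\<bar> \<le> e" "\<bar>x $ 2 - y $ 2\<bar> \<le> e"
  shows "dist x y \<le> 2 * e"
proof -
  have "norm (x - y) \<le> (\<Sum>i\<in>UNIV. \<bar>(x - y) $ i\<bar>)" by (rule norm_le_l1_cart)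
  then show ?thesis using assms by (simp add: dist_norm UNIV_2)
qed

text \<open>The content with exponent \<open>s\<close>, where \<open>1 < s < dim E\<close>, is
  distributed over dyadic cells in a small ball. A ball of radius \<open>(1/2) ^ j\<close> is
  reached by boundedly many cells of depth \<open>2 * j\<close>, each of content at most
  \<open>(4 * (1/2) ^ j) powr s\<close>. With \<open>q = (1/2) powr s\<close>, the condition
  \<open>q < 1/2\<close> expresses that the exponent exceeds 1.\<close>

theorem frostman_planar:
  fixes E :: "(real^2) set"
  assumes E: "compact E" and dim: "hausdorff_dim E > 1"
  obtains \<mu> :: "(real^2) measure" and K q :: real where
    "sets \<mu> = sets borel" "finite_measure \<mu>" "emeasure \<mu> (- E) = 0" "emeasure \<mu> UNIV > 0"
    "0 \<le> q" "q < 1/2" "0 \<le> K" "\<And>x j. measure \<mu> (cball x ((1/2) ^ j)) \<le> K * q ^ j"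
proof -
  obtain s :: real where s: "1 < s" "ereal s < hausdorff_dim E"
    using ereal_dense2[OF dim] by (auto simp: one_ereal_def)
  have "hausdorff_measure s E \<noteq> 0"
  proof
    assume "hausdorff_measure s E = 0"
    then have "hausdorff_dim E \<le> ereal s"
      unfolding hausdorff_dim_def using s by (intro Inf_lower) auto
    then show False using s by simp
  qed
  then have "0 < (SUP \<delta> \<in> {0<..}. hausdorff_content s \<delta> E)"
    by (simp add: hausdorff_measure_def zero_less_iff_neq_zero)
  then obtain \<delta> where \<delta>: "\<delta> > 0" "hausdorff_content s \<delta> E > 0"
    unfolding less_SUP_iff by auto
  \<comment> \<open>\<open>2 * \<rho> \<le> \<delta>\<close> lets every subset of the ball serve as
    its own cover; \<open>2 * \<rho> < 1\<close> is what the parity argument requires.\<close>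
  define \<rho> where "\<rho> = min (\<delta> / 2) (1 / 3)"
  have \<rho>: "0 < \<rho>" "2 * \<rho> \<le> \<delta>" "2 * \<rho> < 1" using \<delta> by (auto simp: \<rho>_def)
  obtain F where F: "finite F" "E \<subseteq> (\<Union>x\<in>F. ball x \<rho>)"
    using compactE_image[OF E, of E "\<lambda>x. ball x \<rho>"] \<rho>(1) by (metis (no_types, lifting) UN_I centre_in_ball open_ball subsetI)
  have "\<exists>x0\<in>F. hausdorff_content s \<delta> (E \<inter> cball x0 \<rho>) \<noteq> 0"
  proof (rule ccontr)
    assume "\<not> ?thesis"
    then have "hausdorff_content s \<delta> (\<Union>x\<in>F. E \<inter> cball x \<rho>) = 0"
      using F \<delta> s by (intro hausdorff_content_finite_UN) auto
    moreover have "E \<subseteq> (\<Union>x\<in>F. E \<inter> cball x \<rho>)" using F(2) ball_subset_cball by blast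
    ultimately show False using hausdorff_content_mono[of E _ s \<delta>] \<delta>(2) by (metis leD)
  qed
  then obtain x0 where x0: "hausdorff_content s \<delta> (E \<inter> cball x0 \<rho>) \<noteq> 0" by auto
  define E0 where "E0 = E \<inter> cball x0 \<rho>"
  have E0: "compact E0" unfolding E0_def using E by (intro compact_Int compact_cball)
  have dist_E0: "dist x y \<le> 2 * \<rho>" if "x \<in> E0" "y \<in> E0" for x y
    using that dist_triangle2[of x y x0] by (auto simp: E0_def dist_commute)
  have diam_sub: "bounded A \<and> diameter A \<le> \<delta>" if "A \<subseteq> E0" for A
  proof
    show "bounded A" using that E0 compact_imp_bounded bounded_subset by blast
    show "diameter A \<le> \<delta>"
    proof (rule diameter_le)
      show "A \<noteq> {} \<or> 0 \<le> \<delta>" using \<delta> by simp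
      fix x y assume "x \<in> A" "y \<in> A"
      then show "norm (x - y) \<le> \<delta>"
        using dist_E0[of x y] that \<rho> unfolding dist_norm by (meson order_trans subsetD)
    qed
  qed
  define c where "c A = enn2real (hausdorff_content s \<delta> A)" for A :: "(real^2) set"
  have content_le: "hausdorff_content s \<delta> A \<le> ennreal (diameter A powr s)" if "A \<subseteq> E0" for A
    using diam_sub[OF that] \<delta> s by (intro hausdorff_content_le_diameter) auto
  have ennreal_c: "ennreal (c A) = hausdorff_content s \<delta> A" if "A \<subseteq> E0" for A
    unfolding c_def using content_le[OF that] by (intro ennreal_enn2real) (auto intro: le_less_trans)
  have c_le: "c A \<le> diameter A powr s" if "A \<subseteq> E0" for A
    using content_le[OF that] unfolding ennreal_c[OF that, symmetric] by (simp add: c_def)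
  let ?c = "cell bit_set E0"
  \<comment> \<open>Depth \<open>2 * j + 2\<close> fixes both floors at scale
    \<open>(1/2) ^ j\<close>, so each coordinate varies by at most that much and the distance by at
    most twice that, which is \<open>4 * (1/2) ^ (j + 1)\<close>. At depths 0 and 1 the value 4
    exceeds the diameter of \<open>E0\<close>.\<close>
  define \<epsilon> :: "nat \<Rightarrow> real" where "\<epsilon> n = 4 * (1/2) ^ (n div 2)" for n
  have cell_sub: "?c b \<subseteq> E0" for b by (induction b) auto
  have diam: "dist x y \<le> \<epsilon> (length b)" if xy: "x \<in> ?c b" "y \<in> ?c b" for b x y
  proof (cases "length b < 2")
    case True
    have "dist x y \<le> 2 * \<rho>" using xy cell_sub by (blast intro: dist_E0)
    then show ?thesis using True \<rho> by (simp add: \<epsilon>_def)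
  next
    case False
    then obtain j where j: "length b div 2 = Suc j" by (metis Suc_pred div_greater_zero_iff not_less pos2)
    have near: "\<bar>z - z'\<bar> \<le> 2 * (1/2) ^ Suc j"
      if "\<lfloor>2 ^ j * z\<rfloor> = \<lfloor>2 ^ j * z'\<rfloor>" for z z' :: real
    proof -
      have "\<bar>2 ^ j * z - 2 ^ j * z'\<bar> \<le> 1" using that by linarith
      then have "2 ^ j * \<bar>z - z'\<bar> \<le> 1" by (simp add: right_diff_distrib[symmetric] abs_mult)
      then show ?thesis by (simp add: power_one_over field_simps)
    qed
    have le1: "\<bar>x $ i - y $ i\<bar> < 1" for i
    proof -
      have "dist x y \<le> 2 * \<rho>" using xy cell_sub by (blast intro: dist_E0)
      then show ?thesis using component_le_norm_cart[of "x - y" i] \<rho> by (simp add: dist_norm)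
    qed
    have "\<lfloor>2 ^ j * x $ 1\<rfloor> = \<lfloor>2 ^ j * y $ 1\<rfloor>"
    proof (rule floor_eq_of_parities[OF le1])
      fix i assume "i \<le> j"
      then have "x \<in> bit_set (2 * i) \<longleftrightarrow> y \<in> bit_set (2 * i)"
        using xy j by (intro cell_bits[OF xy]) linarith
      then show "odd \<lfloor>2 ^ i * x $ 1\<rfloor> \<longleftrightarrow> odd \<lfloor>2 ^ i * y $ 1\<rfloor>" by (simp add: bit_set_def)
    qed
    moreover have "\<lfloor>2 ^ j * x $ 2\<rfloor> = \<lfloor>2 ^ j * y $ 2\<rfloor>"
    proof (rule floor_eq_of_parities[OF le1])
      fix i assume "i \<le> j"
      then have "x \<in> bit_set (2 * i + 1) \<longleftrightarrow> y \<in> bit_set (2 * i + 1)"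
        using xy j by (intro cell_bits[OF xy]) linarith
      then show "odd \<lfloor>2 ^ i * x $ 2\<rfloor> \<longleftrightarrow> odd \<lfloor>2 ^ i * y $ 2\<rfloor>" by (simp add: bit_set_def)
    qed
    ultimately show ?thesis
      using dist_vec2_le[OF near near, of x y] by (simp add: \<epsilon>_def j)
  qed
  have "filterlim (\<lambda>j::nat. j div 2) at_top at_top"
    unfolding filterlim_at_top eventually_sequentially
  proof
    fix Z :: nat
    show "\<exists>N. \<forall>n\<ge>N. Z \<le> n div 2" by (rule exI[of _ "2 * Z"]) auto
  qed
  then have "(\<lambda>j. (1/2::real) ^ (j div 2)) \<longlonglongrightarrow> 0"
    by (rule filterlim_compose[OF LIMSEQ_power_zero, rotated]) simp
  then have lim: "\<epsilon> \<longlonglongrightarrow> 0" unfolding \<epsilon>_def by (rule tendsto_mult_right_zero)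
  have c_pos: "c E0 > 0" using ennreal_c[of E0] x0 by (simp add: E0_def[symmetric] zero_less_iff_neq_zero) (metis c_def enn2real_nonneg ennreal_0 less_eq_real_def)
  have c_nonneg: "0 \<le> c A" for A by (simp add: c_def)
  have c_empty: "c {} = 0" using c_le[of "{}"] by (simp add: c_def) (metis enn2real_nonneg order_antisym)
  have c_Un: "c (A \<union> A') \<le> c A + c A'" if "A \<subseteq> E0" "A' \<subseteq> E0" for A A'
  proof -
    have "ennreal (c (A \<union> A')) \<le> ennreal (c A) + ennreal (c A')"
      using hausdorff_content_Un[of s \<delta> A A'] that by (simp add: ennreal_c)
    also have "\<dots> = ennreal (c A + c A')" by (rule ennreal_plus[symmetric]) (auto simp: c_def)
    finally show ?thesis by (subst (asm) ennreal_le_iff) (auto simp: c_def)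
  qed
  obtain \<mu> :: "(real^2) measure" where \<mu>: "sets \<mu> = sets borel" "finite_measure \<mu>"
    "emeasure \<mu> (- E0) = 0" "emeasure \<mu> UNIV > 0" and
    ball: "\<And>x \<rho> n. measure \<mu> (cball x \<rho>) \<le>
       (\<Sum>b | length b = n \<and> (\<exists>y\<in>?c b. dist x y \<le> \<rho> + \<epsilon> n). c (?c b))"
    by (rule mass_distribution[of E0 c bit_set \<epsilon>, OF E0 c_nonneg c_empty c_pos c_Un diam lim]) (assumption | rule that)+
  show ?thesis
  proof
    show "sets \<mu> = sets borel" by (rule \<mu>)
    show "finite_measure \<mu>" by (rule \<mu>)
    show "emeasure \<mu> UNIV > 0" by (rule \<mu>)
    show "emeasure \<mu> (- E) = 0"
    proof (rule emeasure_eq_0[OF _ \<mu>(3)])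
      have "closed E0" using E0 by (rule compact_imp_closed)
      then show "- E0 \<in> sets \<mu>" by (simp add: \<mu>(1) borel_open open_Compl)
      show "- E \<subseteq> - E0" by (auto simp: E0_def)
    qed
    show "0 \<le> (1/2) powr s" by simp
    show "(1/2) powr s < 1/2" using powr_less_mono'[of "1/2" 1 s] s by simp
    show "0 \<le> 169 * 4 powr s" by simp
    fix x j
    let ?S = "{b. length b = 2 * j \<and> (\<exists>y\<in>?c b. dist x y \<le> (1/2) ^ j + \<epsilon> (2 * j))}"
    define y where "y b = (SOME y. y \<in> ?c b \<and> dist x y \<le> (1/2) ^ j + \<epsilon> (2 * j))" for b
    have y: "y b \<in> ?c b" "dist x (y b) \<le> 5 * (1/2) ^ j" if "b \<in> ?S" for b
    proof -
      have "\<exists>z. z \<in> ?c b \<and> dist x z \<le> (1/2) ^ j + \<epsilon> (2 * j)" using that by blast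
      from someI_ex[OF this] show "y b \<in> ?c b" "dist x (y b) \<le> 5 * (1/2) ^ j"
        unfolding y_def by (auto simp: \<epsilon>_def)
    qed
    define key where "key b = (\<lfloor>2 ^ j * y b $ 1\<rfloor>, \<lfloor>2 ^ j * y b $ 2\<rfloor>)" for b
    \<comment> \<open>After scaling by \<open>2 ^ j\<close> the representatives are within 5 of
      \<open>x\<close>: 1 from the radius and 4 from \<open>\<epsilon> (2 * j)\<close>. Floors then
      differ by at most 6, which leaves \<open>13 * 13 = 169\<close> keys.\<close>
    let ?box = "\<lambda>i. {\<lfloor>2 ^ j * x $ i\<rfloor> - 6..\<lfloor>2 ^ j * x $ i\<rfloor> + 6}"
    have in_box: "\<lfloor>2 ^ j * y b $ i\<rfloor> \<in> ?box i" if "b \<in> ?S" for b i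
    proof -
      have "\<bar>x $ i - y b $ i\<bar> \<le> 5 * (1/2) ^ j"
        using y(2)[OF that] component_le_norm_cart[of "x - y b" i] by (simp add: dist_norm)
      then have "2 ^ j * \<bar>x $ i - y b $ i\<bar> \<le> 5" by (simp add: power_one_over field_simps)
      then have "\<bar>2 ^ j * x $ i - 2 ^ j * y b $ i\<bar> \<le> 5"
        by (simp add: right_diff_distrib[symmetric] abs_mult)
      then show ?thesis by simp linarith
    qed
    have "card ?S \<le> card (?box 1 \<times> ?box 2)"
    proof (rule card_inj_on_le[of key])
      show "inj_on key ?S"
      proof (rule inj_onI)
        fix b b' assume b: "b \<in> ?S" "b' \<in> ?S" "key b = key b'"
        show "b = b'"
        proof (rule cell_inj[OF y(1)[OF b(1)] y(1)[OF b(2)]])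
          fix n assume "n < length b"
          then have "n div 2 \<le> j" using b(1) by auto
          then show "y b \<in> bit_set n \<longleftrightarrow> y b' \<in> bit_set n"
            using b(3) by (simp add: bit_set_def key_def floor_pow2_div[of "n div 2" j])
        qed (use b in auto)
      qed
      show "key ` ?S \<subseteq> ?box 1 \<times> ?box 2" using in_box unfolding key_def by blast
    qed auto
    then have card: "card ?S \<le> 169" by simp
    have "measure \<mu> (cball x ((1/2) ^ j)) \<le> (\<Sum>b\<in>?S. c (?c b))" by (rule ball)
    also have "\<dots> \<le> (\<Sum>b\<in>?S. (4 * (1/2) ^ j) powr s)"
    proof (rule sum_mono)
      fix b assume b: "b \<in> ?S"
      have "diameter (?c b) \<le> 4 * (1/2) ^ j"
        using diam[of _ b] b by (intro diameter_le) (auto simp: \<epsilon>_def dist_norm)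
      then have "diameter (?c b) powr s \<le> (4 * (1/2) ^ j) powr s"
        using s diam_sub[OF cell_sub[of b]] by (intro powr_mono2) (auto intro: diameter_ge_0)
      then show "c (?c b) \<le> (4 * (1/2) ^ j) powr s" using c_le[OF cell_sub[of b]] by linarith
    qed
    also have "\<dots> = card ?S * (4 * (1/2) ^ j) powr s" by simp
    also have "\<dots> \<le> 169 * (4 * (1/2) ^ j) powr s" using card by (intro mult_right_mono) auto
    also have "(4 * (1/2) ^ j) powr s = 4 powr s * ((1/2) powr s) ^ j"
    proof -
      have "((1/2::real) ^ j) powr s = ((1/2) powr s) ^ j"
        by (simp add: powr_realpow[symmetric] powr_powr) (simp add: mult.commute)
      then show ?thesis by (simp add: powr_mult)
    qed
    finally show "measure \<mu> (cball x ((1/2) ^ j)) \<le> 169 * 4 powr s * ((1/2) powr s) ^ j"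
      by (simp add: mult.assoc)
  qed
qed

section \<open>Projections of a Frostman measure\<close>

lemma borel_measurable_vec_nth [measurable (raw)]:
  fixes f :: "'a \<Rightarrow> real ^ 'n"
  assumes "f \<in> borel_measurable M"
  shows "(\<lambda>x. f x $ i) \<in> borel_measurable M"
  by (rule borel_measurable_continuous_on[OF _ assms]) (intro continuous_intros)

text \<open>The unnormalised projection with kernel spanned by \<open>(- a, 1)\<close>. Being affine
  in \<open>a\<close>, it makes estimates over slopes elementary; only the horizontal kernel
  direction is missed.\<close>

definition slope_proj :: "real \<Rightarrow> real^2 \<Rightarrow> real" where
  "slope_proj a v = v $ 1 + a * v $ 2"

lemma slope_proj_diff: "slope_proj a (x - y) = slope_proj a x - slope_proj a y"
  by (simp add: slope_proj_def algebra_simps)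

lemma borel_measurable_slope_proj [measurable (raw)]:
  assumes [measurable]: "f \<in> borel_measurable M" "g \<in> borel_measurable M"
  shows "(\<lambda>x. slope_proj (f x) (g x)) \<in> borel_measurable M"
  unfolding slope_proj_def by measurable

lemma continuous_on_slope_proj: "continuous_on A (slope_proj a)"
  unfolding slope_proj_def by (intro continuous_intros)

lemma ennreal_sum_squares: "(a + b)\<^sup>2 \<le> 2 * a\<^sup>2 + 2 * b\<^sup>2" for a b :: ennreal
proof (cases a)
  case (real x)
  show ?thesis
  proof (cases b)
    case (real y)
    have "(x + y)\<^sup>2 \<le> 2 * x\<^sup>2 + 2 * y\<^sup>2" using zero_le_power2[of "x - y"]
      by (simp add: power2_eq_square algebra_simps)
    then have "ennreal ((x + y)\<^sup>2) \<le> ennreal (2 * x\<^sup>2 + 2 * y\<^sup>2)" by (rule ennreal_leI)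
    then show ?thesis using \<open>a = ennreal x\<close> \<open>0 \<le> x\<close> real
      by (simp add: ennreal_power[symmetric] ennreal_mult)
  qed (simp add: power2_eq_square ennreal_mult_top)
qed (simp add: power2_eq_square ennreal_mult_top)

lemma ennreal_le_inverse_mult:
  assumes "r > 0" "ennreal r * x \<le> y"
  shows "x \<le> ennreal (1 / r) * y"
proof -
  have "ennreal (1 / r) * (ennreal r * x) = x"
    using assms(1) by (simp add: mult.assoc[symmetric] ennreal_mult[symmetric])
  then show ?thesis using mult_left_mono[OF assms(2), of "ennreal (1 / r)"] by simp
qed

section \<open>Sets of slopes and a dyadic majorant of the 1-energy kernel\<close>

text \<open>If the second coordinate of \<open>v\<close> is comparable with \<open>norm v\<close>,
  the slopes lie in an interval of half-length \<open>r / \<bar>v $ 2\<bar>\<close>. Otherwise a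
  single such slope forces \<open>norm v \<le> 2 * r\<close>, and the trivial bound
  \<open>2 * M\<close> suffices.\<close>

lemma emeasure_slopes_near_zero:
  assumes v: "v \<noteq> 0" and M: "0 \<le> M" and r: "0 < r"
  shows "emeasure lborel {a. \<bar>a\<bar> \<le> M \<and> \<bar>slope_proj a v\<bar> \<le> r} \<le> ennreal (4 * (1 + M) * r / norm v)"
    (is "emeasure _ ?A \<le> _")
proof (cases "norm v \<le> 2 * (1 + M) * \<bar>v $ 2\<bar>")
  case True
  then have v2: "v $ 2 \<noteq> 0" using v by auto
  define c where "c = - v $ 1 / v $ 2"
  define h where "h = r / \<bar>v $ 2\<bar>"
  have "?A \<subseteq> {c - h..c + h}"
  proof
    fix a assume "a \<in> ?A"
    moreover have "slope_proj a v = v $ 2 * (a - c)" using v2 by (simp add: slope_proj_def c_def field_simps)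
    ultimately have "\<bar>v $ 2\<bar> * \<bar>a - c\<bar> \<le> r" by (simp add: abs_mult)
    then have "\<bar>a - c\<bar> \<le> h" using v2 by (simp add: h_def field_simps)
    then show "a \<in> {c - h..c + h}" by auto
  qed
  then have "emeasure lborel ?A \<le> emeasure lborel {c - h..c + h}" by (intro emeasure_mono) auto
  also have "\<dots> = ennreal (2 * h)" using r by (simp add: h_def)
  also have "2 * h \<le> 4 * (1 + M) * r / norm v"
  proof -
    have "2 * r * norm v \<le> 2 * r * (2 * (1 + M) * \<bar>v $ 2\<bar>)" using True r by (intro mult_left_mono) auto
    then show ?thesis using v2 v by (simp add: h_def field_simps)
  qed
  finally show ?thesis by (simp add: ennreal_leI)
next
  case False
  show ?thesis
  proof (cases "?A = {}")
    case nonempty: False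
    then obtain a where a: "\<bar>a\<bar> \<le> M" "\<bar>slope_proj a v\<bar> \<le> r" by auto
    have "norm v \<le> \<bar>v $ 1\<bar> + \<bar>v $ 2\<bar>" using norm_le_l1_cart[of v] by (simp add: UNIV_2)
    moreover have "\<bar>a * v $ 2\<bar> \<le> M * \<bar>v $ 2\<bar>" using a by (auto simp: abs_mult intro: mult_right_mono)
    ultimately have "norm v \<le> r + (1 + M) * \<bar>v $ 2\<bar>"
      using a(2) unfolding slope_proj_def by (simp add: algebra_simps)
    then have "norm v \<le> 2 * r" using False by linarith
    have "emeasure lborel ?A \<le> emeasure lborel {-M..M}" by (intro emeasure_mono) auto
    also have "\<dots> = ennreal (2 * M)" using M by simp
    also have "\<dots> \<le> ennreal (4 * (1 + M) * r / norm v)"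
    proof (rule ennreal_leI)
      have "M * norm v \<le> (1 + M) * (2 * r)" using M r \<open>norm v \<le> 2 * r\<close> by (intro mult_mono) auto
      then show "2 * M \<le> 4 * (1 + M) * r / norm v" using v by (simp add: field_simps)
    qed
    finally show ?thesis .
  next
    case empty: True
    show ?thesis unfolding empty by simp
  qed
qed

text \<open>A majorant of \<open>1 / norm v\<close> whose integral against a Frostman measure is
  read off from masses of dyadic balls. It is infinite at \<open>v = 0\<close>, unlike
  \<open>1 / norm 0\<close>, which is 0 by convention.\<close>

definition dyadic_kernel :: "real^2 \<Rightarrow> ennreal" where
  "dyadic_kernel v = 1 + (\<Sum>k. ennreal (2 ^ Suc k) * indicator {v. norm v \<le> (1/2) ^ k} v)"

lemma borel_measurable_dyadic_kernel [measurable]: "dyadic_kernel \<in> borel_measurable borel"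
  unfolding dyadic_kernel_def by measurable

lemma dyadic_kernel_ge:
  assumes "norm v \<le> (1/2) ^ k"
  shows "ennreal (2 ^ Suc k) \<le> dyadic_kernel v"
proof -
  have "ennreal (2 ^ Suc k) = (\<Sum>i\<in>{k}. ennreal (2 ^ Suc i) * indicator {v. norm v \<le> (1/2) ^ i} v)"
    using assms by simp
  also have "\<dots> \<le> (\<Sum>i. ennreal (2 ^ Suc i) * indicator {v. norm v \<le> (1/2) ^ i} v)"
    by (rule sum_le_suminf) auto
  also have "\<dots> \<le> dyadic_kernel v" unfolding dyadic_kernel_def by simp
  finally show ?thesis .
qed

lemma inverse_norm_le_dyadic_kernel:
  assumes "v \<noteq> 0"
  shows "ennreal (1 / norm v) \<le> dyadic_kernel v"
proof (cases "norm v \<ge> 1")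
  case True
  then have "ennreal (1 / norm v) \<le> ennreal 1" by (intro ennreal_leI) (simp add: divide_le_eq)
  also have "\<dots> \<le> dyadic_kernel v" unfolding dyadic_kernel_def by simp
  finally show ?thesis .
next
  case False
  \<comment> \<open>The first dyadic radius below \<open>norm v\<close>; its predecessor still
    bounds \<open>norm v\<close>, and the corresponding term alone is large enough.\<close>
  define k where "k = (LEAST k. (1/2) ^ k < norm v)"
  obtain m where "(1/2::real) ^ m < norm v" using real_arch_pow_inv[of "norm v" "1/2"] assms by auto
  then have k: "(1/2) ^ k < norm v" unfolding k_def by (rule LeastI)
  then obtain j where j: "k = Suc j" using False by (cases k) auto
  have "norm v \<le> (1/2) ^ j" using not_less_Least[of j "\<lambda>k. (1/2) ^ k < norm v"] j by (simp add: k_def)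
  then have "ennreal (2 ^ Suc j) \<le> dyadic_kernel v" by (rule dyadic_kernel_ge)
  moreover have "1 / norm v \<le> 2 ^ Suc j" using k assms unfolding j by (simp add: power_one_over field_simps)
  ultimately show ?thesis using ennreal_leI order_trans by blast
qed

lemma emeasure_slopes_le_dyadic_kernel:
  assumes M: "0 \<le> M" and r: "0 < r"
  shows "emeasure lborel {a. \<bar>a\<bar> \<le> M \<and> \<bar>slope_proj a v\<bar> \<le> r} \<le> ennreal (4 * (1 + M) * r) * dyadic_kernel v"
proof (cases "v = 0")
  case False
  have "emeasure lborel {a. \<bar>a\<bar> \<le> M \<and> \<bar>slope_proj a v\<bar> \<le> r} \<le> ennreal (4 * (1 + M) * r * (1 / norm v))"
    using emeasure_slopes_near_zero[OF False M r] by simp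
  also have "\<dots> = ennreal (4 * (1 + M) * r) * ennreal (1 / norm v)"
    using M r by (intro ennreal_mult) auto
  also have "\<dots> \<le> ennreal (4 * (1 + M) * r) * dyadic_kernel v"
    by (intro mult_left_mono inverse_norm_le_dyadic_kernel False) auto
  finally show ?thesis .
next
  case True
  \<comment> \<open>For \<open>v = 0\<close> all slopes count, a set of length \<open>2 * M\<close>;
    as the kernel is infinite there, one far term dominates.\<close>
  obtain n where n: "2 * M / (4 * (1 + M) * r) < 2 ^ n" using real_arch_pow[of 2] by auto
  have pos: "4 * (1 + M) * r > 0" using M r by simp
  have "2 * M \<le> 4 * (1 + M) * r * 2 ^ n" using n pos by (simp add: pos_divide_less_eq mult.commute less_imp_le)
  also have "\<dots> \<le> 4 * (1 + M) * r * 2 ^ Suc n" using pos by (intro mult_left_mono) auto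
  finally have le: "2 * M \<le> 4 * (1 + M) * r * 2 ^ Suc n" .
  have "emeasure lborel {a. \<bar>a\<bar> \<le> M \<and> \<bar>slope_proj a v\<bar> \<le> r} \<le> emeasure lborel {-M..M}"
    by (intro emeasure_mono) auto
  also have "\<dots> = ennreal (2 * M)" using M by simp
  also have "\<dots> \<le> ennreal (4 * (1 + M) * r * 2 ^ Suc n)" using le by (rule ennreal_leI)
  also have "\<dots> = ennreal (4 * (1 + M) * r) * ennreal (2 ^ Suc n)"
    using M r by (intro ennreal_mult) auto
  also have "\<dots> \<le> ennreal (4 * (1 + M) * r) * dyadic_kernel v"
    using True by (intro mult_left_mono dyadic_kernel_ge) auto
  finally show ?thesis .
qed

section \<open>Pair counts, window masses and the energy of a projection\<close>

locale frostman_measure = finite_measure \<mu> for \<mu> :: "(real^2) measure" +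
  fixes K q :: real
  assumes sets_\<mu> [measurable_cong]: "sets \<mu> = sets borel"
    and q: "0 \<le> q" "q < 1/2" and K: "0 \<le> K"
    and measure_cball: "measure \<mu> (cball x ((1/2) ^ j)) \<le> K * q ^ j"
begin

lemma space_\<mu> [simp]: "space \<mu> = UNIV"
  using sets_eq_imp_space_eq[OF sets_\<mu>] by simp

lemma emeasure_UNIV_less_top: "emeasure \<mu> UNIV < top"
  by (metis emeasure_finite infinity_ennreal_def less_top)

sublocale PP: finite_measure "\<mu> \<Otimes>\<^sub>M \<mu>"
  by (intro finite_measure_pair_measure finite_measure_axioms)

sublocale P: pair_sigma_finite \<mu> \<mu> ..

text \<open>The \<open>k\<close>-th term of the kernel contributes at most
  \<open>2 ^ Suc k * K * q ^ k\<close>, and this geometric series converges since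
  \<open>2 * q < 1\<close>.\<close>

lemma energy_bound: "\<exists>C<\<infinity>. \<forall>x. (\<integral>\<^sup>+y. dyadic_kernel (x - y) \<partial>\<mu>) \<le> C"
proof (intro exI conjI allI)
  let ?C = "emeasure \<mu> UNIV + (\<Sum>k. ennreal (2 * K * (2 * q) ^ k))"
  have "summable (\<lambda>k. 2 * K * (2 * q) ^ k)"
    using q by (intro summable_mult summable_geometric) auto
  then have "(\<Sum>k. ennreal (2 * K * (2 * q) ^ k)) \<noteq> \<infinity>"
    using q K by (subst suminf_ennreal2) auto
  then show "?C < \<infinity>" using emeasure_UNIV_less_top by (simp add: top.not_eq_extremum)
  fix x
  have "(\<integral>\<^sup>+y. dyadic_kernel (x - y) \<partial>\<mu>) = emeasure \<mu> UNIV +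
      (\<Sum>k. \<integral>\<^sup>+y. ennreal (2 ^ Suc k) * indicator {v. norm v \<le> (1/2) ^ k} (x - y) \<partial>\<mu>)"
    unfolding dyadic_kernel_def by (simp add: nn_integral_add nn_integral_suminf)
  also have "\<dots> \<le> ?C"
  proof (intro add_left_mono suminf_le)
    fix k
    have "(\<integral>\<^sup>+y. ennreal (2 ^ Suc k) * indicator {v. norm v \<le> (1/2) ^ k} (x - y) \<partial>\<mu>) =
        (\<integral>\<^sup>+y. ennreal (2 ^ Suc k) * indicator (cball x ((1/2) ^ k)) y \<partial>\<mu>)"
      by (intro nn_integral_cong) (auto simp: indicator_def dist_norm)
    also have "\<dots> = ennreal (2 ^ Suc k) * ennreal (measure \<mu> (cball x ((1/2) ^ k)))"
      by (subst nn_integral_cmult_indicator) (auto simp: emeasure_eq_measure)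
    also have "\<dots> \<le> ennreal (2 ^ Suc k) * ennreal (K * q ^ k)"
      by (intro mult_left_mono ennreal_leI measure_cball) auto
    also have "\<dots> = ennreal (2 * K * (2 * q) ^ k)"
      using K q by (subst ennreal_mult[symmetric]) (auto simp: power_mult_distrib mult_ac)
    finally show "(\<integral>\<^sup>+y. ennreal (2 ^ Suc k) * indicator {v. norm v \<le> (1/2) ^ k} (x - y) \<partial>\<mu>)
        \<le> ennreal (2 * K * (2 * q) ^ k)" .
  qed auto
  finally show "(\<integral>\<^sup>+y. dyadic_kernel (x - y) \<partial>\<mu>) \<le> ?C" .
qed

definition near_pairs :: "real \<Rightarrow> real \<Rightarrow> ennreal" where
  "near_pairs r a = (\<integral>\<^sup>+p. indicator {p. \<bar>slope_proj a (fst p - snd p)\<bar> \<le> r} p \<partial>(\<mu> \<Otimes>\<^sub>M \<mu>))"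

text \<open>The tent \<open>max 0 (r - \<bar>t\<bar>)\<close> is the overlap of two intervals of
  length \<open>r\<close> at distance \<open>\<bar>t\<bar>\<close>. This links counts of pairs to
  squared window masses.\<close>

definition fejer :: "real \<Rightarrow> real \<Rightarrow> ennreal" where
  "fejer r a = (\<integral>\<^sup>+p. ennreal (max 0 (r - \<bar>slope_proj a (fst p - snd p)\<bar>)) \<partial>(\<mu> \<Otimes>\<^sub>M \<mu>))"

text \<open>Half-open windows, so that two adjacent ones add up exactly to one of double
  length.\<close>

definition window :: "real \<Rightarrow> real \<Rightarrow> real \<Rightarrow> ennreal" where
  "window r a z = (\<integral>\<^sup>+x. indicator {x. z \<le> slope_proj a x \<and> slope_proj a x < z + r} x \<partial>\<mu>)"

lemma borel_measurable_near_pairs [measurable]: "near_pairs r \<in> borel_measurable borel"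
  unfolding near_pairs_def by measurable

lemma borel_measurable_fejer [measurable]: "fejer r \<in> borel_measurable borel"
  unfolding fejer_def by measurable

lemma borel_measurable_window [measurable]: "window r a \<in> borel_measurable borel"
  unfolding window_def by measurable

text \<open>Fubini's theorem puts the integral over slopes inside, where a pair contributes at most
  a multiple of \<open>r\<close> times the kernel; the energy bound then integrates the
  kernel.\<close>

lemma near_pairs_integral:
  assumes M: "0 \<le> M"
  shows "\<exists>C<\<infinity>. \<forall>r>0. (\<integral>\<^sup>+a. near_pairs r a * indicator {-M..M} a \<partial>lborel) \<le> ennreal r * C"
proof -
  interpret L: pair_sigma_finite "\<mu> \<Otimes>\<^sub>M \<mu>" "lborel :: real measure" ..
  obtain C where C: "C < \<infinity>" "\<And>x. (\<integral>\<^sup>+y. dyadic_kernel (x - y) \<partial>\<mu>) \<le> C"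
    using energy_bound by auto
  let ?D = "ennreal (4 * (1 + M)) * (C * emeasure \<mu> UNIV)"
  have "?D < \<infinity>" using C emeasure_UNIV_less_top by (simp add: ennreal_mult_less_top)
  moreover have "(\<integral>\<^sup>+a. near_pairs r a * indicator {-M..M} a \<partial>lborel) \<le> ennreal r * ?D" if r: "r > 0" for r
  proof -
    let ?f = "\<lambda>p a. indicator {a. \<bar>a\<bar> \<le> M \<and> \<bar>slope_proj a (fst p - snd p)\<bar> \<le> r} a :: ennreal"
    have "(\<integral>\<^sup>+a. near_pairs r a * indicator {-M..M} a \<partial>lborel) =
        (\<integral>\<^sup>+a. (\<integral>\<^sup>+p. ?f p a \<partial>(\<mu> \<Otimes>\<^sub>M \<mu>)) \<partial>lborel)"
      unfolding near_pairs_def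
      by (subst nn_integral_multc[symmetric]) (auto intro!: nn_integral_cong simp: indicator_def)
    also have "\<dots> = (\<integral>\<^sup>+p. (\<integral>\<^sup>+a. ?f p a \<partial>lborel) \<partial>(\<mu> \<Otimes>\<^sub>M \<mu>))"
      by (rule L.Fubini') measurable
    also have "\<dots> \<le> (\<integral>\<^sup>+p. ennreal (4 * (1 + M) * r) * dyadic_kernel (fst p - snd p) \<partial>(\<mu> \<Otimes>\<^sub>M \<mu>))"
    proof (rule nn_integral_mono)
      fix p
      have "(\<integral>\<^sup>+a. ?f p a \<partial>lborel) = emeasure lborel {a. \<bar>a\<bar> \<le> M \<and> \<bar>slope_proj a (fst p - snd p)\<bar> \<le> r}"
        by (rule nn_integral_indicator) measurable
      then show "(\<integral>\<^sup>+a. ?f p a \<partial>lborel) \<le> ennreal (4 * (1 + M) * r) * dyadic_kernel (fst p - snd p)"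
        using emeasure_slopes_le_dyadic_kernel[OF M r] by simp
    qed
    also have "\<dots> = ennreal (4 * (1 + M) * r) * (\<integral>\<^sup>+p. dyadic_kernel (fst p - snd p) \<partial>(\<mu> \<Otimes>\<^sub>M \<mu>))"
      by (rule nn_integral_cmult) measurable
    also have "(\<integral>\<^sup>+p. dyadic_kernel (fst p - snd p) \<partial>(\<mu> \<Otimes>\<^sub>M \<mu>)) =
        (\<integral>\<^sup>+x. (\<integral>\<^sup>+y. dyadic_kernel (x - y) \<partial>\<mu>) \<partial>\<mu>)"
      by (subst nn_integral_fst[symmetric]) auto
    also have "\<dots> \<le> (\<integral>\<^sup>+x. C \<partial>\<mu>)" by (intro nn_integral_mono C)
    also have "\<dots> = C * emeasure \<mu> UNIV" by simp
    also have "ennreal (4 * (1 + M) * r) * (C * emeasure \<mu> UNIV) = ennreal r * ?D"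
      using r M by (subst ennreal_mult) (auto simp: mult_ac)
    finally show ?thesis by (simp add: mult_left_mono)
  qed
  ultimately show ?thesis by blast
qed

lemma emeasure_translates_Int:
  assumes "0 \<le> r"
  shows "emeasure lborel {z :: real. (z \<le> s \<and> s < z + r) \<and> z \<le> t \<and> t < z + r} = ennreal (max 0 (r - \<bar>s - t\<bar>))"
proof -
  have "{z :: real. (z \<le> s \<and> s < z + r) \<and> z \<le> t \<and> t < z + r} = {max s t - r<..min s t}" by auto
  moreover have "max s t - r \<le> min s t \<or> min s t < max s t - r" by linarith
  ultimately show ?thesis using assms by (auto simp: max_def min_def)
qed

text \<open>The squared window mass is a double integral over pairs. After exchanging integrals, a
  pair contributes the length of the set of \<open>z\<close> whose window contains both
  projections.\<close>

lemma fejer_eq_window: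
  assumes r: "0 \<le> r"
  shows "fejer r a = (\<integral>\<^sup>+z. (window r a z)\<^sup>2 \<partial>lborel)"
proof -
  interpret L: pair_sigma_finite "\<mu> \<Otimes>\<^sub>M \<mu>" "lborel :: real measure" ..
  let ?W = "\<lambda>z. {x. z \<le> slope_proj a x \<and> slope_proj a x < z + r}"
  have sq: "(window r a z)\<^sup>2 = (\<integral>\<^sup>+p. indicator (?W z) (fst p) * indicator (?W z) (snd p) \<partial>(\<mu> \<Otimes>\<^sub>M \<mu>))" for z
    unfolding window_def power2_eq_square
    by (subst nn_integral_fst[symmetric]) (auto simp: nn_integral_cmult nn_integral_multc)
  have "(\<integral>\<^sup>+z. (window r a z)\<^sup>2 \<partial>lborel) =
      (\<integral>\<^sup>+p. (\<integral>\<^sup>+z. indicator (?W z) (fst p) * indicator (?W z) (snd p) \<partial>lborel) \<partial>(\<mu> \<Otimes>\<^sub>M \<mu>))"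
    unfolding sq by (rule L.Fubini') measurable
  also have "\<dots> = fejer r a"
    unfolding fejer_def
  proof (rule nn_integral_cong)
    fix p :: "(real^2) \<times> (real^2)"
    let ?s = "slope_proj a (fst p)" and ?t = "slope_proj a (snd p)"
    have "(\<integral>\<^sup>+z. indicator (?W z) (fst p) * indicator (?W z) (snd p) \<partial>lborel) =
        (\<integral>\<^sup>+z. indicator {z. (z \<le> ?s \<and> ?s < z + r) \<and> z \<le> ?t \<and> ?t < z + r} z \<partial>lborel)"
      by (intro nn_integral_cong) (auto simp: indicator_def)
    also have "\<dots> = emeasure lborel {z. (z \<le> ?s \<and> ?s < z + r) \<and> z \<le> ?t \<and> ?t < z + r}"
      by (rule nn_integral_indicator) measurable
    also have "\<dots> = ennreal (max 0 (r - \<bar>slope_proj a (fst p - snd p)\<bar>))"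
      by (simp only: emeasure_translates_Int[OF r] slope_proj_diff)
    finally show "(\<integral>\<^sup>+z. indicator (?W z) (fst p) * indicator (?W z) (snd p) \<partial>lborel) =
        ennreal (max 0 (r - \<bar>slope_proj a (fst p - snd p)\<bar>))" .
  qed
  finally show ?thesis by simp
qed

lemma fejer_double:
  assumes r: "0 \<le> r"
  shows "fejer (2 * r) a \<le> 4 * fejer r a"
proof -
  \<comment> \<open>The form \<open>r + 1 * z\<close> matches the affine substitution rule that
    removes the translation below.\<close>
  have win: "window (2 * r) a z = window r a z + window r a (r + 1 * z)" for z
  proof -
    let ?I = "\<lambda>l u x. indicator {x. l \<le> slope_proj a x \<and> slope_proj a x < u} x :: ennreal"
    have "window r a z + window r a (r + 1 * z) =
        (\<integral>\<^sup>+x. ?I z (z + r) x + ?I (r + 1 * z) (r + 1 * z + r) x \<partial>\<mu>)"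
      unfolding window_def by (rule nn_integral_add[symmetric]) measurable
    also have "\<dots> = window (2 * r) a z"
      unfolding window_def by (rule nn_integral_cong) (use r in \<open>auto simp: indicator_def\<close>)
    finally show ?thesis by simp
  qed
  have "fejer (2 * r) a = (\<integral>\<^sup>+z. (window r a z + window r a (r + 1 * z))\<^sup>2 \<partial>lborel)"
    using r by (subst fejer_eq_window) (auto simp: win)
  also have "\<dots> \<le> (\<integral>\<^sup>+z. 2 * (window r a z)\<^sup>2 + 2 * (window r a (r + 1 * z))\<^sup>2 \<partial>lborel)"
    by (intro nn_integral_mono ennreal_sum_squares)
  also have "\<dots> = 2 * (\<integral>\<^sup>+z. (window r a z)\<^sup>2 \<partial>lborel) + 2 * (\<integral>\<^sup>+z. (window r a (r + 1 * z))\<^sup>2 \<partial>lborel)"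
    by (simp add: nn_integral_add nn_integral_cmult)
  also have "(\<integral>\<^sup>+z. (window r a (r + 1 * z))\<^sup>2 \<partial>lborel) = (\<integral>\<^sup>+z. (window r a z)\<^sup>2 \<partial>lborel)"
    using nn_integral_real_affine[of "\<lambda>z. (window r a z)\<^sup>2" 1 r] by simp
  also have "2 * (\<integral>\<^sup>+z. (window r a z)\<^sup>2 \<partial>lborel) + 2 * (\<integral>\<^sup>+z. (window r a z)\<^sup>2 \<partial>lborel) =
      4 * (\<integral>\<^sup>+z. (window r a z)\<^sup>2 \<partial>lborel)"
    by (simp add: distrib_right[symmetric])
  finally show ?thesis by (simp add: fejer_eq_window[OF r])
qed

lemma fejer_le_near_pairs: "0 \<le> r \<Longrightarrow> fejer r a \<le> ennreal r * near_pairs r a"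
  unfolding fejer_def near_pairs_def
  by (subst nn_integral_cmult[symmetric])
    (auto intro!: nn_integral_mono ennreal_leI simp: indicator_def)

text \<open>The tent of width \<open>2 * r\<close> is still at least \<open>r\<close> at distance at
  most \<open>r\<close>.\<close>

lemma near_pairs_le_fejer: "ennreal r * near_pairs r a \<le> fejer (2 * r) a"
  unfolding fejer_def near_pairs_def
  by (subst nn_integral_cmult[symmetric])
    (auto intro!: nn_integral_mono ennreal_leI simp: indicator_def)

text \<open>The function \<open>T\<close> of the overview, with \<open>4 ^ n\<close> in the role of
  \<open>1 / r\<^sup>2\<close>. It is the squared L2 norm of the density of the projected measure,
  and infinite if there is no such density.\<close>

definition proj_energy :: "real \<Rightarrow> ennreal" where
  "proj_energy a = (SUP n. ennreal (4 ^ n) * fejer ((1/2) ^ n) a)"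

lemma borel_measurable_proj_energy [measurable]: "proj_energy \<in> borel_measurable borel"
  unfolding proj_energy_def by measurable

lemma incseq_fejer: "incseq (\<lambda>n. ennreal (4 ^ n) * fejer ((1/2) ^ n) a)"
proof (rule incseq_SucI)
  fix n
  have "ennreal (4 ^ n) * fejer ((1/2) ^ n) a \<le> ennreal (4 ^ n) * (4 * fejer ((1/2) ^ Suc n) a)"
    using fejer_double[of "(1/2) ^ Suc n" a] by (intro mult_left_mono) auto
  also have "\<dots> = ennreal (4 ^ n * 4) * fejer ((1/2) ^ Suc n) a"
    by (simp add: ennreal_mult mult.assoc)
  finally show "ennreal (4 ^ n) * fejer ((1/2) ^ n) a \<le> ennreal (4 ^ Suc n) * fejer ((1/2) ^ Suc n) a"
    by (simp add: mult.commute)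
qed

lemma fejer_le_proj_energy: "fejer ((1/2) ^ n) a \<le> ennreal ((1/4) ^ n) * proj_energy a"
proof -
  have "ennreal (4 ^ n) * fejer ((1/2) ^ n) a \<le> proj_energy a"
    unfolding proj_energy_def by (rule SUP_upper) simp
  then show ?thesis using ennreal_le_inverse_mult[of "4 ^ n"] by (simp add: power_one_over)
qed

text \<open>The comparison with a tent doubles the radius, which leads to the preceding dyadic
  scale; hence the index \<open>Suc n\<close>.\<close>

lemma near_pairs_le_proj_energy:
  "near_pairs ((1/2) ^ Suc n) a \<le> ennreal (4 * (1/2) ^ Suc n) * proj_energy a"
proof -
  let ?r = "(1/2::real) ^ Suc n"
  have "ennreal ?r * near_pairs ?r a \<le> ennreal ((1/4) ^ n) * proj_energy a"
    using near_pairs_le_fejer[of ?r a] fejer_le_proj_energy[of n a] by simp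
  then have "near_pairs ?r a \<le> ennreal (1 / ?r) * (ennreal ((1/4) ^ n) * proj_energy a)"
    by (rule ennreal_le_inverse_mult[rotated]) simp
  also have "\<dots> = ennreal (1 / ?r * (1/4) ^ n) * proj_energy a"
    by (simp add: mult.assoc[symmetric] ennreal_mult[symmetric])
  also have "1 / ?r * (1/4) ^ n = 4 * ?r"
    by (simp add: power_one_over field_simps power_mult_distrib[symmetric])
  finally show ?thesis .
qed

text \<open>Monotone convergence reduces this to a bound uniform in \<open>n\<close>. One factor
  \<open>r\<close> comes from the tent and one from the integrated pair count, and together they
  cancel \<open>4 ^ n\<close>.\<close>

lemma proj_energy_integral:
  assumes M: "0 \<le> M"
  shows "(\<integral>\<^sup>+a. proj_energy a * indicator {-M..M} a \<partial>lborel) < \<infinity>"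
proof -
  obtain C where C: "C < \<infinity>"
    "\<And>r. r > 0 \<Longrightarrow> (\<integral>\<^sup>+a. near_pairs r a * indicator {-M..M} a \<partial>lborel) \<le> ennreal r * C"
    using near_pairs_integral[OF M] by auto
  let ?f = "\<lambda>n a. ennreal (4 ^ n) * fejer ((1/2) ^ n) a * indicator {-M..M} a"
  have "(\<integral>\<^sup>+a. proj_energy a * indicator {-M..M} a \<partial>lborel) = (\<integral>\<^sup>+a. (SUP n. ?f n a) \<partial>lborel)"
    unfolding proj_energy_def by (simp add: SUP_mult_right_ennreal)
  also have "\<dots> = (SUP n. \<integral>\<^sup>+a. ?f n a \<partial>lborel)"
    by (rule nn_integral_monotone_convergence_SUP)
      (auto simp: incseq_def le_fun_def intro!: mult_right_mono incseqD[OF incseq_fejer])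
  also have "\<dots> \<le> C"
  proof (rule SUP_least)
    fix n
    let ?r = "(1/2::real) ^ n"
    have "(\<integral>\<^sup>+a. ?f n a \<partial>lborel) \<le>
        (\<integral>\<^sup>+a. ennreal (4 ^ n * ?r) * (near_pairs ?r a * indicator {-M..M} a) \<partial>lborel)"
    proof (rule nn_integral_mono)
      fix a
      have "ennreal (4 ^ n) * fejer ?r a \<le> ennreal (4 ^ n) * (ennreal ?r * near_pairs ?r a)"
        by (intro mult_left_mono fejer_le_near_pairs) auto
      then show "?f n a \<le> ennreal (4 ^ n * ?r) * (near_pairs ?r a * indicator {-M..M} a)"
        by (auto simp: ennreal_mult mult.assoc indicator_def)
    qed
    also have "\<dots> = ennreal (4 ^ n * ?r) * (\<integral>\<^sup>+a. near_pairs ?r a * indicator {-M..M} a \<partial>lborel)"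
      by (rule nn_integral_cmult) measurable
    also have "\<dots> \<le> ennreal (4 ^ n * ?r) * (ennreal ?r * C)"
      by (intro mult_left_mono C) auto
    also have "\<dots> = ennreal (4 ^ n * ?r * ?r) * C"
      by (subst (2) ennreal_mult) (auto simp: mult.assoc)
    also have "4 ^ n * ?r * ?r = 1"
      by (simp add: power_mult_distrib[symmetric])
    finally show "(\<integral>\<^sup>+a. ?f n a \<partial>lborel) \<le> C" by simp
  qed
  also note C(1)
  finally show ?thesis .
qed

lemma AE_proj_energy_finite: "AE a in lborel. proj_energy a < \<infinity>"
proof -
  have "AE a in lborel. \<forall>M::nat. proj_energy a * indicator {- real M..real M} a \<noteq> \<infinity>"
    unfolding AE_all_countable
  proof
    fix M :: nat
    show "AE a in lborel. proj_energy a * indicator {- real M..real M} a \<noteq> \<infinity>"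
      using proj_energy_integral[of "real M"] by (intro nn_integral_PInf_AE) auto
  qed
  then show ?thesis
  proof eventually_elim
    case (elim a)
    obtain M :: nat where "\<bar>a\<bar> \<le> real M" using real_arch_simple by auto
    then have "a \<in> {- real M..real M}" by auto
    then show ?case using spec[OF elim, of M] by (simp add: top.not_eq_extremum)
  qed
qed

text \<open>Suppose the image is null and cover it by an open \<open>U\<close> of length below
  \<open>e\<close>. For small dyadic \<open>r\<close>, all windows meeting the projection of
  \<open>A\<close> start in \<open>U\<close>, so \<open>r * \<mu> A\<close> is at most the integral
  of \<open>window r a\<close> over \<open>U\<close>. By Cauchy-Schwarz its square is at most
  \<open>e * r\<^sup>2 * T a\<close>; dividing by \<open>r\<^sup>2\<close> and letting
  \<open>e\<close> tend to 0 gives \<open>\<mu> A = 0\<close>.\<close>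

lemma emeasure_slope_proj_pos:
  assumes fin: "proj_energy a < \<infinity>" and A: "compact A" and pos: "emeasure \<mu> A > 0"
  shows "emeasure lborel (slope_proj a ` A) > 0"
proof (rule ccontr)
  interpret L: pair_sigma_finite \<mu> "lborel :: real measure" ..
  have [measurable]: "A \<in> sets borel" using A by (simp add: borel_closed compact_imp_closed)
  let ?K = "slope_proj a ` A"
  have K: "compact ?K" by (intro compact_continuous_image continuous_on_slope_proj A)
  assume "\<not> emeasure lborel ?K > 0"
  then have null: "emeasure lborel ?K = 0" by simp
  have bound: "(emeasure \<mu> A)\<^sup>2 \<le> ennreal e * proj_energy a" if e: "e > 0" for e
  proof -
    obtain U where U: "open U" "?K \<subseteq> U" "emeasure lborel (U - ?K) < ennreal e"
      using outer_regular_lborel[of ?K e] K e by (auto simp: borel_closed compact_imp_closed)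
    have [measurable]: "U \<in> sets borel" using U by simp
    have "emeasure lborel U \<le> emeasure lborel (U - ?K) + emeasure lborel ?K"
      using K by (intro emeasure_subadditive[THEN order_trans[rotated]] emeasure_mono)
        (auto simp: borel_closed compact_imp_closed)
    then have Ue: "emeasure lborel U \<le> ennreal e" using U(3) null by simp
    obtain d where d: "d > 0" "(\<Union>k\<in>?K. ball k d) \<subseteq> U"
      using compact_subset_open_imp_ball_epsilon_subset[OF K U(1,2)] by auto
    obtain n where n: "(1/2::real) ^ n < d" using real_arch_pow_inv[OF d(1), of "1/2"] by auto
    let ?r = "(1/2::real) ^ n"
    let ?f = "\<lambda>x z. indicator A x * indicator {z. z \<le> slope_proj a x \<and> slope_proj a x < z + ?r} z :: ennreal"
    have "ennreal ?r * emeasure \<mu> A = (\<integral>\<^sup>+x. ennreal ?r * indicator A x \<partial>\<mu>)"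
      by (subst nn_integral_cmult_indicator) auto
    also have "\<dots> = (\<integral>\<^sup>+x. (\<integral>\<^sup>+z. ?f x z \<partial>lborel) \<partial>\<mu>)"
    proof (rule nn_integral_cong)
      fix x
      have "{z. z \<le> slope_proj a x \<and> slope_proj a x < z + ?r} = {slope_proj a x - ?r<..slope_proj a x}" by auto
      then have "(\<integral>\<^sup>+z. indicator {z. z \<le> slope_proj a x \<and> slope_proj a x < z + ?r} z \<partial>lborel) = ennreal ?r"
        by (simp add: nn_integral_indicator)
      then show "ennreal ?r * indicator A x = (\<integral>\<^sup>+z. ?f x z \<partial>lborel)"
        by (subst nn_integral_cmult) (auto simp: mult.commute)
    qed
    also have "\<dots> = (\<integral>\<^sup>+z. (\<integral>\<^sup>+x. ?f x z \<partial>\<mu>) \<partial>lborel)"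
      by (rule L.Fubini'[symmetric]) measurable
    also have "\<dots> \<le> (\<integral>\<^sup>+z. indicator U z * window ?r a z \<partial>lborel)"
    proof (rule nn_integral_mono)
      fix z
      have "(\<integral>\<^sup>+x. ?f x z \<partial>\<mu>) \<le> (\<integral>\<^sup>+x. indicator U z *
          indicator {x. z \<le> slope_proj a x \<and> slope_proj a x < z + ?r} x \<partial>\<mu>)"
      proof (rule nn_integral_mono)
        fix x
        have "z \<in> U" if "x \<in> A" "z \<le> slope_proj a x" "slope_proj a x < z + ?r"
        proof -
          have "z \<in> ball (slope_proj a x) d" using that n by (auto simp: dist_real_def)
          then show ?thesis using d(2) that(1) by blast
        qed
        then show "?f x z \<le> indicator U z *
            indicator {x. z \<le> slope_proj a x \<and> slope_proj a x < z + ?r} x"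
          by (auto simp: indicator_def)
      qed
      also have "\<dots> = indicator U z * window ?r a z"
        unfolding window_def by (rule nn_integral_cmult) measurable
      finally show "(\<integral>\<^sup>+x. ?f x z \<partial>\<mu>) \<le> indicator U z * window ?r a z" .
    qed
    finally have "(ennreal ?r * emeasure \<mu> A)\<^sup>2 \<le> (\<integral>\<^sup>+z. indicator U z * window ?r a z \<partial>lborel)\<^sup>2"
      by (rule power_mono) simp
    also have "\<dots> \<le> (\<integral>\<^sup>+z. (indicator U z)\<^sup>2 \<partial>lborel) * (\<integral>\<^sup>+z. (window ?r a z)\<^sup>2 \<partial>lborel)"
      by (rule Cauchy_Schwarz_nn_integral) measurable
    also have "(\<integral>\<^sup>+z. (indicator U z)\<^sup>2 \<partial>lborel) = (\<integral>\<^sup>+z. indicator U z \<partial>lborel)"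
      by (intro nn_integral_cong) (auto simp: indicator_def)
    also have "\<dots> = emeasure lborel U" by simp
    also have "emeasure lborel U * (\<integral>\<^sup>+z. (window ?r a z)\<^sup>2 \<partial>lborel) = emeasure lborel U * fejer ?r a"
      by (simp add: fejer_eq_window)
    also have "\<dots> \<le> ennreal e * (ennreal ((1/4) ^ n) * proj_energy a)"
      by (intro mult_mono Ue fejer_le_proj_energy) auto
    also have "(ennreal ?r * emeasure \<mu> A)\<^sup>2 = ennreal (?r * ?r) * (emeasure \<mu> A)\<^sup>2"
      by (simp add: power2_eq_square ennreal_mult mult_ac)
    also have "?r * ?r = (1/4) ^ n" by (simp add: power_mult_distrib[symmetric])
    finally have "ennreal ((1/4) ^ n) * (emeasure \<mu> A)\<^sup>2 \<le> ennreal ((1/4) ^ n) * (ennreal e * proj_energy a)"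
      by (simp add: mult_ac)
    then show ?thesis
      by (subst (asm) ennreal_mult_le_mult_iff) auto
  qed
  obtain T where T: "proj_energy a = ennreal T" "0 \<le> T" using fin by (cases "proj_energy a") auto
  have small: "(emeasure \<mu> A)\<^sup>2 \<le> ennreal e" if "e > 0" for e
  proof -
    \<comment> \<open>The denominator \<open>T + 1\<close> avoids a division by zero when
      \<open>T = 0\<close>.\<close>
    have "(emeasure \<mu> A)\<^sup>2 \<le> ennreal (e / (T + 1)) * ennreal T"
      using bound[of "e / (T + 1)"] that T by simp
    also have "\<dots> = ennreal (e / (T + 1) * T)" using that T by (intro ennreal_mult[symmetric]) auto
    also have "\<dots> \<le> ennreal e" using that T by (intro ennreal_leI) (simp add: field_simps)
    finally show ?thesis .
  qed
  have "(emeasure \<mu> A)\<^sup>2 \<le> 0"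
  proof (rule ennreal_le_epsilon)
    fix e :: real assume "0 < e"
    from small[OF this] show "(emeasure \<mu> A)\<^sup>2 \<le> 0 + ennreal e" by simp
  qed
  then have "(emeasure \<mu> A)\<^sup>2 = 0" by (rule antisym) simp
  then show False using pos unfolding power2_eq_square by (metis less_irrefl mult_eq_0_iff)
qed

end

section \<open>Slopes of almost all pairs\<close>

text \<open>The parameter \<open>a\<close> whose projection \<open>slope_proj a\<close> annihilates
  \<open>v\<close>, not the usual rise over run.\<close>

definition slope :: "real^2 \<Rightarrow> real" where
  "slope v = - (v $ 1) / (v $ 2)"

lemma borel_measurable_slope [measurable (raw)]:
  assumes [measurable]: "f \<in> borel_measurable M"
  shows "(\<lambda>x. slope (f x)) \<in> borel_measurable M"
  unfolding slope_def by measurable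

lemma slope_proj_eq: "v $ 2 \<noteq> 0 \<Longrightarrow> slope_proj a v = (a - slope v) * v $ 2"
  by (simp add: slope_proj_def slope_def field_simps)

context frostman_measure
begin

text \<open>A unit segment is covered by \<open>2 ^ j + 1\<close> balls of radius
  \<open>(1/2) ^ j\<close>, whose total mass is at most \<open>2 * K * (2 * q) ^ j\<close> and tends
  to 0. This disposes of the one direction without a slope.\<close>

lemma emeasure_horizontal_line: "emeasure \<mu> {y. y $ 2 = c} = 0"
proof -
  define S where "S i = {y::real^2. y $ 2 = c \<and> of_int i \<le> y $ 1 \<and> y $ 1 \<le> of_int i + 1}" for i
  have S_meas [measurable]: "S i \<in> sets \<mu>" for i unfolding S_def by measurable
  have "measure \<mu> (S i) = 0" for i
  proof -
    have bound: "measure \<mu> (S i) \<le> 2 * K * (2 * q) ^ j" for j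
    proof -
      define p :: "nat \<Rightarrow> real^2" where "p k = (\<chi> l. if l = 1 then of_int i + real k / 2 ^ j else c)" for k
      have cover: "S i \<subseteq> (\<Union>k\<in>{..2 ^ j}. cball (p k) ((1/2) ^ j))"
      proof
        fix y assume y: "y \<in> S i"
        define t where "t = 2 ^ j * (y $ 1 - of_int i)"
        define k where "k = nat \<lfloor>t\<rfloor>"
        have t: "0 \<le> t" "t \<le> 2 ^ j" using y by (auto simp: t_def S_def)
        have "real k \<le> t" "t < real k + 1" using t unfolding k_def by linarith+
        then have k: "real k \<le> 2 ^ j" "\<bar>t - real k\<bar> \<le> 1" using t by linarith+
        have "k \<le> 2 ^ j" using k(1) by simp
        have "\<bar>p k $ 1 - y $ 1\<bar> = \<bar>t - real k\<bar> / 2 ^ j"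
        proof -
          have "p k $ 1 - y $ 1 = - ((t - real k) / 2 ^ j)" by (simp add: p_def t_def field_simps)
          then show ?thesis by (simp add: abs_divide)
        qed
        also have "\<dots> \<le> 1 / 2 ^ j" using k(2) by (intro divide_right_mono) auto
        finally have 1: "\<bar>p k $ 1 - y $ 1\<bar> \<le> (1/2) ^ j" by (simp add: power_one_over)
        have "p k $ 2 - y $ 2 = 0" using y by (simp add: p_def S_def)
        then have "dist (p k) y \<le> (1/2) ^ j"
          using norm_le_l1_cart[of "p k - y"] 1 by (simp add: dist_norm UNIV_2)
        then show "y \<in> (\<Union>k\<in>{..2 ^ j}. cball (p k) ((1/2) ^ j))" using \<open>k \<le> 2 ^ j\<close> by auto
      qed
      have "measure \<mu> (S i) \<le> measure \<mu> (\<Union>k\<in>{..2 ^ j}. cball (p k) ((1/2) ^ j))"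
        by (intro finite_measure_mono cover) (auto simp: sets_\<mu>)
      also have "\<dots> \<le> (\<Sum>k\<in>{..2 ^ j}. measure \<mu> (cball (p k) ((1/2) ^ j)))"
        by (intro finite_measure_subadditive_finite) (auto simp: sets_\<mu>)
      also have "\<dots> \<le> (\<Sum>k\<in>{..(2::nat) ^ j}. K * q ^ j)" by (intro sum_mono measure_cball)
      also have "\<dots> = (2 ^ j + 1) * (K * q ^ j)" by simp
      also have "\<dots> \<le> (2 * 2 ^ j) * (K * q ^ j)" using K q by (intro mult_right_mono) auto
      also have "\<dots> = 2 * K * (2 * q) ^ j" by (simp add: power_mult_distrib)
      finally show ?thesis .
    qed
    have "(\<lambda>j. 2 * K * (2 * q) ^ j) \<longlonglongrightarrow> 0"
      using q by (intro tendsto_mult_right_zero LIMSEQ_power_zero) auto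
    then have "measure \<mu> (S i) \<le> 0" by (rule Lim_bounded2) (use bound in blast)
    then show ?thesis using measure_nonneg[of \<mu> "S i"] by linarith
  qed
  then have "S i \<in> null_sets \<mu>" for i
    by (intro null_setsI S_meas) (simp add: emeasure_eq_measure)
  then have "emeasure \<mu> (\<Union>i. S i) = 0" by (intro null_setsD1 null_sets_UN)
  moreover have "{y. y $ 2 = c} \<subseteq> (\<Union>i. S i)"
  proof
    fix y :: "real^2" assume "y \<in> {y. y $ 2 = c}"
    then have "y \<in> S \<lfloor>y $ 1\<rfloor>" unfolding S_def by simp
    then show "y \<in> (\<Union>i. S i)" by blast
  qed
  ultimately show ?thesis by (rule emeasure_eq_0[rotated]) measurable
qed

text \<open>The height bound turns closeness of slopes into smallness of \<open>slope_proj\<close>,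
  and the slope bound keeps to an interval where \<open>proj_energy\<close> is integrable. These
  sets exhaust all pairs of different heights as \<open>M\<close> grows.\<close>

definition steep :: "real \<Rightarrow> ((real^2) \<times> (real^2)) set" where
  "steep M = {p. (fst p - snd p) $ 2 \<noteq> 0 \<and> \<bar>(fst p - snd p) $ 2\<bar> \<le> M \<and> \<bar>slope (fst p - snd p)\<bar> \<le> M}"

lemma measurable_steep [measurable]: "Measurable.pred (\<mu> \<Otimes>\<^sub>M \<mu>) (\<lambda>p. p \<in> steep M)"
  unfolding steep_def mem_Collect_eq by measurable

text \<open>Each pair with slope in \<open>U\<close> is charged to the slopes within \<open>r / M\<close> of its own, for which it is
  counted by \<open>near_pairs r\<close>.\<close>

lemma nn_integral_steep_slope_le:
  assumes M: "1 \<le> M" and U: "open U"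
  shows "(\<integral>\<^sup>+p. indicator {p \<in> steep M. slope (fst p - snd p) \<in> U} p \<partial>(\<mu> \<Otimes>\<^sub>M \<mu>)) \<le>
    ennreal (2 * M) * (\<integral>\<^sup>+a. proj_energy a * indicator {- (M + 1)..M + 1} a * indicator U a \<partial>lborel)"
proof -
  interpret L: pair_sigma_finite "\<mu> \<Otimes>\<^sub>M \<mu>" "lborel :: real measure" ..
  have [measurable]: "U \<in> sets borel" using U by simp
  let ?s = "\<lambda>p. slope (fst p - snd p)"
  let ?r = "\<lambda>n. (1/2::real) ^ Suc n"
  let ?I = "\<lambda>a. indicator {- (M + 1)..M + 1} a * indicator U a :: ennreal"
  let ?g = "\<lambda>n p a. indicator (steep M) p * indicator {a. \<bar>a - ?s p\<bar> * M \<le> ?r n} a * ?I a :: ennreal"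
  \<comment> \<open>The interval of slopes charged by a pair has length \<open>2 * ?r n / M\<close>,
    and the factor in front is its reciprocal. So \<open>?h n p\<close> reaches 1 once that interval
    lies in \<open>U\<close>.\<close>
  let ?h = "\<lambda>n p. ennreal (M / (2 * ?r n)) * (\<integral>\<^sup>+a. ?g n p a \<partial>lborel)"
  have [measurable]: "indicator (steep M) \<in> borel_measurable (\<mu> \<Otimes>\<^sub>M \<mu>)"
    by (rule borel_measurable_indicator') measurable
  have [measurable]: "(\<lambda>(p, a). ?g n p a) \<in> borel_measurable ((\<mu> \<Otimes>\<^sub>M \<mu>) \<Otimes>\<^sub>M lborel)" for n
    by measurable
  have "(\<integral>\<^sup>+p. indicator {p \<in> steep M. ?s p \<in> U} p \<partial>(\<mu> \<Otimes>\<^sub>M \<mu>)) \<le> (\<integral>\<^sup>+p. liminf (\<lambda>n. ?h n p) \<partial>(\<mu> \<Otimes>\<^sub>M \<mu>))"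
  proof (rule nn_integral_mono)
    fix p
    show "indicator {p \<in> steep M. ?s p \<in> U} p \<le> liminf (\<lambda>n. ?h n p)"
    proof (cases "p \<in> steep M \<and> ?s p \<in> U")
      case True
      obtain d where d: "d > 0" "ball (?s p) d \<subseteq> U" using U True openE by blast
      have "(\<lambda>n. ?r n) \<longlonglongrightarrow> 0" by (rule LIMSEQ_Suc) (rule LIMSEQ_power_zero, simp)
      then have "eventually (\<lambda>n. ?r n < d) sequentially" using d(1) by (rule order_tendstoD)
      then have "eventually (\<lambda>n. 1 \<le> ?h n p) sequentially"
      proof eventually_elim
        case (elim n)
        let ?w = "?r n / M"
        have w: "0 \<le> ?w" "?w < d" "?w \<le> 1"
        proof -
          have "?w \<le> ?r n" using M by (simp add: divide_le_eq mult_le_cancel_left1)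
          moreover have "?r n \<le> 1" by (rule power_le_one) auto
          ultimately show "?w < d" "?w \<le> 1" using elim by linarith+
        qed (use M in auto)
        have "\<bar>?s p\<bar> \<le> M" using True by (simp add: steep_def)
        have ball: "{?s p - ?w..?s p + ?w} \<subseteq> U"
        proof
          fix a assume "a \<in> {?s p - ?w..?s p + ?w}"
          then have "a \<in> ball (?s p) d" using w(2) unfolding mem_ball dist_real_def atLeastAtMost_iff by linarith
          then show "a \<in> U" using d(2) by blast
        qed
        have one: "1 = ennreal (M / (2 * ?r n)) * ennreal (2 * ?w)"
          using M by (subst ennreal_mult[symmetric]) auto
        have "ennreal (2 * ?w) = (\<integral>\<^sup>+a. indicator {?s p - ?w..?s p + ?w} a \<partial>lborel)"
          using w(1) by (simp add: nn_integral_indicator)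
        also have "\<dots> \<le> (\<integral>\<^sup>+a. ?g n p a \<partial>lborel)"
        proof (rule nn_integral_mono)
          fix a
          show "indicator {?s p - ?w..?s p + ?w} a \<le> ?g n p a"
          proof (cases "a \<in> {?s p - ?w..?s p + ?w}")
            case a: True
            then have le: "\<bar>a - ?s p\<bar> \<le> ?w" unfolding atLeastAtMost_iff by linarith
            then have "\<bar>a - ?s p\<bar> * M \<le> ?r n" using M by (simp add: pos_le_divide_eq)
            moreover have "a \<in> {- (M + 1)..M + 1}"
              using le w(3) \<open>\<bar>?s p\<bar> \<le> M\<close> unfolding atLeastAtMost_iff by linarith
            ultimately show ?thesis using True a ball by (auto simp: indicator_def)
          qed simp
        qed
        finally show ?case unfolding one by (rule mult_left_mono) simp
      qed
      then have "1 \<le> liminf (\<lambda>n. ?h n p)" by (rule Liminf_bounded)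
      then show ?thesis using True by simp
    qed simp
  qed
  \<comment> \<open>Fatou's lemma, since the scale at which the interval fits into \<open>U\<close>
    depends on the pair.\<close>
  also have "\<dots> \<le> liminf (\<lambda>n. \<integral>\<^sup>+p. ?h n p \<partial>(\<mu> \<Otimes>\<^sub>M \<mu>))"
    by (rule nn_integral_liminf) measurable
  also have "\<dots> \<le> liminf (\<lambda>n::nat. ennreal (2 * M) * (\<integral>\<^sup>+a. proj_energy a * ?I a \<partial>lborel))"
  proof (rule Liminf_mono, rule always_eventually, rule allI)
    fix n
    have h: "(\<integral>\<^sup>+p. ?h n p \<partial>(\<mu> \<Otimes>\<^sub>M \<mu>)) =
        ennreal (M / (2 * ?r n)) * (\<integral>\<^sup>+p. (\<integral>\<^sup>+a. ?g n p a \<partial>lborel) \<partial>(\<mu> \<Otimes>\<^sub>M \<mu>))"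
      by (rule nn_integral_cmult) measurable
    have "(\<integral>\<^sup>+p. (\<integral>\<^sup>+a. ?g n p a \<partial>lborel) \<partial>(\<mu> \<Otimes>\<^sub>M \<mu>)) =
        (\<integral>\<^sup>+a. (\<integral>\<^sup>+p. ?g n p a \<partial>(\<mu> \<Otimes>\<^sub>M \<mu>)) \<partial>lborel)"
      by (rule L.Fubini'[symmetric]) measurable
    also have "\<dots> \<le> (\<integral>\<^sup>+a. ennreal (4 * ?r n) * (proj_energy a * ?I a) \<partial>lborel)"
    proof (rule nn_integral_mono)
      fix a
      have "(\<integral>\<^sup>+p. ?g n p a \<partial>(\<mu> \<Otimes>\<^sub>M \<mu>)) \<le>
          (\<integral>\<^sup>+p. indicator {p. \<bar>slope_proj a (fst p - snd p)\<bar> \<le> ?r n} p * ?I a \<partial>(\<mu> \<Otimes>\<^sub>M \<mu>))"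
      proof (rule nn_integral_mono)
        fix p :: "(real^2) \<times> (real^2)"
        let ?v = "fst p - snd p"
        have "\<bar>slope_proj a ?v\<bar> \<le> ?r n" if "p \<in> steep M" "\<bar>a - ?s p\<bar> * M \<le> ?r n"
        proof -
          have v: "?v $ 2 \<noteq> 0" "\<bar>?v $ 2\<bar> \<le> M" using that(1) unfolding steep_def by auto
          have "slope_proj a ?v = (a - ?s p) * ?v $ 2"
            by (rule slope_proj_eq[OF v(1)])
          then have "\<bar>slope_proj a ?v\<bar> = \<bar>a - ?s p\<bar> * \<bar>?v $ 2\<bar>" by (simp only: abs_mult)
          also have "\<dots> \<le> \<bar>a - ?s p\<bar> * M" using v(2) by (intro mult_left_mono) auto
          finally show ?thesis using that(2) by linarith
        qed
        then show "?g n p a \<le> indicator {p. \<bar>slope_proj a (fst p - snd p)\<bar> \<le> ?r n} p * ?I a"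
          by (auto simp: indicator_def)
      qed
      also have "\<dots> = near_pairs (?r n) a * ?I a"
        unfolding near_pairs_def by (rule nn_integral_multc) measurable
      also have "\<dots> \<le> ennreal (4 * ?r n) * proj_energy a * ?I a"
        by (intro mult_right_mono near_pairs_le_proj_energy) auto
      finally show "(\<integral>\<^sup>+p. ?g n p a \<partial>(\<mu> \<Otimes>\<^sub>M \<mu>)) \<le> ennreal (4 * ?r n) * (proj_energy a * ?I a)"
        by (simp only: mult.assoc)
    qed
    also have "\<dots> = ennreal (4 * ?r n) * (\<integral>\<^sup>+a. proj_energy a * ?I a \<partial>lborel)"
      by (rule nn_integral_cmult) measurable
    finally have "(\<integral>\<^sup>+p. ?h n p \<partial>(\<mu> \<Otimes>\<^sub>M \<mu>)) \<le>
        ennreal (M / (2 * ?r n)) * (ennreal (4 * ?r n) * (\<integral>\<^sup>+a. proj_energy a * ?I a \<partial>lborel))"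
      unfolding h by (rule mult_left_mono) simp
    also have "\<dots> = ennreal (M / (2 * ?r n) * (4 * ?r n)) * (\<integral>\<^sup>+a. proj_energy a * ?I a \<partial>lborel)"
      using M by (subst ennreal_mult) (auto simp: mult.assoc)
    also have "M / (2 * ?r n) * (4 * ?r n) = 2 * M" by (simp add: field_simps)
    finally show "(\<integral>\<^sup>+p. ?h n p \<partial>(\<mu> \<Otimes>\<^sub>M \<mu>)) \<le>
        ennreal (2 * M) * (\<integral>\<^sup>+a. proj_energy a * ?I a \<partial>lborel)" .
  qed
  also have "\<dots> = ennreal (2 * M) * (\<integral>\<^sup>+a. proj_energy a * ?I a \<partial>lborel)"
    by (rule Liminf_const) simp
  finally show ?thesis by (simp only: mult.assoc)
qed

text \<open>The finite measure with density \<open>proj_energy\<close> on a bounded interval gives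
  mass 0 to the Lebesgue null set of bad slopes. By outer regularity that set has open
  neighbourhoods of arbitrarily small mass, to which the bound for open sets applies.\<close>

lemma AE_steep_slope_finite:
  assumes M: "1 \<le> M"
  shows "AE p in \<mu> \<Otimes>\<^sub>M \<mu>. p \<in> steep M \<longrightarrow> proj_energy (slope (fst p - snd p)) < \<infinity>"
proof -
  define N where "N = density lborel (\<lambda>a. proj_energy a * indicator {- (M + 1)..M + 1} a)"
  have [simp]: "sets N = sets borel" by (simp add: N_def)
  have em_N: "emeasure N A = (\<integral>\<^sup>+a. proj_energy a * indicator {- (M + 1)..M + 1} a * indicator A a \<partial>lborel)"
    if "A \<in> sets borel" for A
    unfolding N_def using that by (subst emeasure_density) auto
  define B where "B = {a. proj_energy a = \<infinity>}"
  have B [measurable]: "B \<in> sets borel" unfolding B_def by measurable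
  have "AE a in lborel. proj_energy a * indicator {- (M + 1)..M + 1} a * indicator B a = 0"
    using AE_proj_energy_finite by eventually_elim (auto simp: B_def)
  then have "emeasure N B = 0" by (subst em_N) (auto simp: nn_integral_0_iff_AE)
  moreover have "emeasure N (space N) \<noteq> \<infinity>"
    using proj_energy_integral[of "M + 1"] M sets_eq_imp_space_eq[OF \<open>sets N = sets borel\<close>]
    by (simp add: em_N)
  ultimately have inf: "(INF U\<in>{U. B \<subseteq> U \<and> open U}. emeasure N U) = 0"
    using outer_regular[of N B] B by simp
  have small: "(\<integral>\<^sup>+p. indicator {p \<in> steep M. slope (fst p - snd p) \<in> B} p \<partial>(\<mu> \<Otimes>\<^sub>M \<mu>)) \<le> 0 + ennreal e"
    if "e > 0" for e :: real
  proof -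
    have "(INF U\<in>{U. B \<subseteq> U \<and> open U}. emeasure N U) < ennreal (e / (2 * M))"
      using inf that M by simp
    then obtain U where U: "B \<subseteq> U" "open U" "emeasure N U < ennreal (e / (2 * M))"
      by (auto simp: INF_less_iff)
    have "(\<integral>\<^sup>+p. indicator {p \<in> steep M. slope (fst p - snd p) \<in> B} p \<partial>(\<mu> \<Otimes>\<^sub>M \<mu>)) \<le>
        (\<integral>\<^sup>+p. indicator {p \<in> steep M. slope (fst p - snd p) \<in> U} p \<partial>(\<mu> \<Otimes>\<^sub>M \<mu>))"
      using U(1) by (intro nn_integral_mono) (auto simp: indicator_def)
    also have "\<dots> \<le> ennreal (2 * M) * emeasure N U"
      using nn_integral_steep_slope_le[OF M U(2)] U(2) by (subst em_N) auto
    also have "\<dots> \<le> ennreal (2 * M) * ennreal (e / (2 * M))"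
      using U(3) by (intro mult_left_mono) auto
    also have "\<dots> = ennreal e" using M that by (subst ennreal_mult[symmetric]) auto
    finally show ?thesis by simp
  qed
  have "(\<integral>\<^sup>+p. indicator {p \<in> steep M. slope (fst p - snd p) \<in> B} p \<partial>(\<mu> \<Otimes>\<^sub>M \<mu>)) \<le> 0"
    by (rule ennreal_le_epsilon) (rule small)
  then have "(\<integral>\<^sup>+p. indicator {p \<in> steep M. slope (fst p - snd p) \<in> B} p \<partial>(\<mu> \<Otimes>\<^sub>M \<mu>)) = 0"
    by (rule antisym) simp
  then have "AE p in \<mu> \<Otimes>\<^sub>M \<mu>. indicator {p \<in> steep M. slope (fst p - snd p) \<in> B} p = (0::ennreal)"
    by (subst (asm) nn_integral_0_iff_AE) auto
  then show ?thesis
    by eventually_elim (auto simp: indicator_def B_def top.not_eq_extremum split: if_splits)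
qed

lemma AE_pair_slope_finite:
  "AE x in \<mu>. AE y in \<mu>. x $ 2 \<noteq> y $ 2 \<and> proj_energy (slope (x - y)) < \<infinity>"
proof -
  have "AE p in \<mu> \<Otimes>\<^sub>M \<mu>. \<forall>M::nat. p \<in> steep (real M + 1) \<longrightarrow> proj_energy (slope (fst p - snd p)) < \<infinity>"
    unfolding AE_all_countable using AE_steep_slope_finite by auto
  from P.AE_pair[OF this] show ?thesis
  proof eventually_elim
    case (elim x)
    have "{y. y $ 2 = x $ 2} \<in> null_sets \<mu>"
      using emeasure_horizontal_line by (intro null_setsI) auto
    then have "AE y in \<mu>. y \<notin> {y. y $ 2 = x $ 2}" by (rule AE_not_in)
    with elim show ?case
    proof eventually_elim
      case (elim y)
      obtain M :: nat where M: "max \<bar>(x - y) $ 2\<bar> \<bar>slope (x - y)\<bar> \<le> real M" using real_arch_simple by blast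
      have "(x, y) \<in> steep (real M + 1)" using elim(2) M by (auto simp: steep_def)
      then show ?case using elim spec[OF elim(1), of M] by auto
    qed
  qed
qed

end

section \<open>Chains of triangles\<close>

lemma triangle_area_eq:
  "triangle_area x y z =
    \<bar>(z $ 1 - x $ 1) * (y $ 2 - x $ 2) - (y $ 1 - x $ 1) * (z $ 2 - x $ 2)\<bar> / 2"
  unfolding triangle_area_def
  by (subst measure_completion) (auto simp: content_triangle intro!: borel_closed compact_imp_closed finite_imp_compact_convex_hull)

lemma continuous_on_triangle_area [continuous_intros]:
  assumes "continuous_on S f" "continuous_on S g" "continuous_on S h"
  shows "continuous_on S (\<lambda>p. triangle_area (f p) (g p) (h p))"
  unfolding triangle_area_eq using assms by (intro continuous_intros) auto

text \<open>The area depends on \<open>z\<close> only through its signed distance to the line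
  through \<open>x\<close> and \<open>y\<close>, and the projection along that line is an affine
  function of this distance.\<close>

lemma triangle_area_slope:
  assumes "x $ 2 \<noteq> y $ 2"
  shows "triangle_area x y z =
    \<bar>(x $ 2 - y $ 2) / 2 * (slope_proj (slope (x - y)) z - slope_proj (slope (x - y)) x)\<bar>"
proof -
  let ?a = "slope (x - y)"
  have a: "?a * (x $ 2 - y $ 2) = - (x $ 1 - y $ 1)"
    using assms by (simp add: slope_def)
  have "(x $ 2 - y $ 2) / 2 * (slope_proj ?a z - slope_proj ?a x) =
      ((x $ 2 - y $ 2) * (z $ 1 - x $ 1) + (?a * (x $ 2 - y $ 2)) * (z $ 2 - x $ 2)) / 2"
    by (simp add: slope_proj_def field_simps)
  also have "\<dots> = - ((z $ 1 - x $ 1) * (y $ 2 - x $ 2) - (y $ 1 - x $ 1) * (z $ 2 - x $ 2)) / 2"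
    unfolding a by (simp add: algebra_simps)
  finally show ?thesis by (simp add: triangle_area_eq abs_divide)
qed

lemma emeasure_affine_vimage_null:
  fixes c t :: real
  assumes I [measurable]: "I \<in> sets borel" and null: "emeasure lborel I = 0" and c: "c \<noteq> 0"
  shows "{s. t + c * s \<in> I} \<in> null_sets lborel"
proof (rule null_setsI)
  show "{s. t + c * s \<in> I} \<in> sets lborel" by measurable
  have "0 = ennreal \<bar>c\<bar> * (\<integral>\<^sup>+s. indicator I (t + c * s) \<partial>lborel)"
    using nn_integral_real_affine[of "indicator I" c t] c null by simp
  then have "(\<integral>\<^sup>+s. indicator I (t + c * s) \<partial>lborel) = 0" using c by simp
  moreover have "(\<integral>\<^sup>+s. indicator I (t + c * s) \<partial>lborel) = (\<integral>\<^sup>+s. indicator {s. t + c * s \<in> I} s \<partial>lborel)"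
    by (intro nn_integral_cong) (auto simp: indicator_def)
  moreover have "\<dots> = emeasure lborel {s. t + c * s \<in> I}"
    by (rule nn_integral_indicator) measurable
  ultimately show "emeasure lborel {s. t + c * s \<in> I} = 0" by simp
qed

text \<open>The absolute value has two affine branches. Were the areas a null set, its preimages
  under both would be null and would cover the projection of \<open>A\<close>.\<close>

lemma (in frostman_measure) emeasure_triangle_areas_pos:
  assumes xy: "x $ 2 \<noteq> y $ 2" and fin: "proj_energy (slope (x - y)) < \<infinity>"
    and A: "compact A" "emeasure \<mu> A > 0"
  shows "emeasure lborel (triangle_area x y ` A) > 0"
proof (rule ccontr)
  let ?I = "triangle_area x y ` A" and ?u = "slope_proj (slope (x - y))"
  assume "\<not> emeasure lborel ?I > 0"
  then have null: "emeasure lborel ?I = 0" by simp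
  have "compact ?I" using A by (intro compact_continuous_image continuous_intros)
  then have I: "?I \<in> sets borel" by (simp add: borel_closed compact_imp_closed)
  define c where "c = (x $ 2 - y $ 2) / 2"
  define t where "t = c * ?u x"
  have c: "c \<noteq> 0" using xy by (simp add: c_def)
  have area: "triangle_area x y z = \<bar>c * ?u z - t\<bar>" for z
    unfolding triangle_area_slope[OF xy] c_def[symmetric] t_def by (simp only: right_diff_distrib)
  have "?u ` A \<subseteq> {s. - t + c * s \<in> ?I} \<union> {s. t + (- c) * s \<in> ?I}"
  proof
    fix s assume "s \<in> ?u ` A"
    then obtain z where z: "z \<in> A" "s = ?u z" by auto
    then have "\<bar>c * s - t\<bar> \<in> ?I" using area[of z] by (metis image_eqI)
    moreover have "\<bar>c * s - t\<bar> = - t + c * s \<or> \<bar>c * s - t\<bar> = t + (- c) * s" by auto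
    ultimately show "s \<in> {s. - t + c * s \<in> ?I} \<union> {s. t + (- c) * s \<in> ?I}" by auto
  qed
  moreover have "{s. - t + c * s \<in> ?I} \<union> {s. t + (- c) * s \<in> ?I} \<in> null_sets lborel"
    using c by (intro null_sets.Un emeasure_affine_vimage_null I null) auto
  ultimately have "emeasure lborel (?u ` A) = 0"
    by (meson emeasure_eq_0 null_setsD1 null_setsD2)
  then show False using emeasure_slope_proj_pos[OF fin A] by simp
qed

section \<open>Sets of chain areas and their measurability\<close>

text \<open>The first index \<open>m\<close> is variable because chains are built from their far
  end.\<close>

definition areas :: "nat \<Rightarrow> nat \<Rightarrow> (nat \<Rightarrow> real^2) \<Rightarrow> nat \<Rightarrow> real" where
  "areas m k p = (\<lambda>j\<in>{m..k}. triangle_area (p j) (p (j + 1)) (p (j + 2)))"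

text \<open>Tychonoff's theorem. It is applied with \<open>{0}\<close> as the factor at indices
  outside the chain, which keeps the product compact.\<close>

lemma compact_Pi_UNIV:
  fixes D :: "'i \<Rightarrow> 'a::topological_space set"
  assumes "\<And>i. compact (D i)"
  shows "compact {p. \<forall>i. p i \<in> D i}"
proof -
  have "{p. \<forall>i. p i \<in> D i} = PiE UNIV D" by auto
  then show ?thesis
    using assms compactin_PiE[of "\<lambda>_. euclidean" UNIV D] by (simp add: euclidean_product_topology)
qed

text \<open>The image is compact, hence Borel in the space of all functions. The inclusion of the
  finite product into that space is measurable coordinate by coordinate, the coordinates outside
  \<open>{m..k}\<close> being constantly \<open>undefined\<close>.\<close>

lemma sets_areas_image:
  assumes "compact S"
  shows "areas m k ` S \<in> sets (Pi\<^sub>M {m..k} (\<lambda>_. lborel))"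
proof -
  let ?P = "Pi\<^sub>M {m..k} (\<lambda>_. lborel :: real measure)"
  have "continuous_on S (areas m k)"
  proof (rule continuous_on_coordinatewise_then_product)
    fix j
    show "continuous_on S (\<lambda>p. areas m k p j)"
    proof (cases "j \<in> {m..k}")
      case True
      have "continuous_on S (\<lambda>p. triangle_area (p j) (p (j + 1)) (p (j + 2)))"
        by (intro continuous_intros continuous_on_product_coordinates continuous_on_subset[OF _ subset_UNIV])
      then show ?thesis using True by (simp add: areas_def)
    next
      case False
      then have eq: "(\<lambda>p. areas m k p j) = (\<lambda>_. undefined)" by (auto simp: areas_def)
      show ?thesis unfolding eq by (rule continuous_on_const)
    qed
  qed
  then have "compact (areas m k ` S)" using assms by (rule compact_continuous_image)
  then have "areas m k ` S \<in> sets borel" by (simp add: borel_closed compact_imp_closed)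
  moreover have "(\<lambda>x. x) \<in> measurable ?P borel"
  proof (rule measurable_coordinatewise_then_product)
    fix j
    show "(\<lambda>x. x j) \<in> borel_measurable ?P"
    proof (cases "j \<in> {m..k}")
      case False
      have "(\<lambda>x. x j) \<in> borel_measurable ?P \<longleftrightarrow> (\<lambda>_. undefined :: real) \<in> borel_measurable ?P"
        by (rule measurable_cong) (use False in \<open>auto simp: space_PiM PiE_def extensional_def\<close>)
      then show ?thesis by simp
    qed measurable
  qed
  ultimately have "(\<lambda>x. x) -` (areas m k ` S) \<inter> space ?P \<in> sets ?P" by (rule measurable_sets[rotated])
  moreover have "areas m k ` S \<subseteq> space ?P" by (auto simp: areas_def space_PiM)
  ultimately show ?thesis by (simp add: Int_absorb2)
qed

text \<open>Triangle \<open>i\<close> introduces the vertex \<open>i + 2\<close>, drawn from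
  \<open>A i\<close>. Distinctness will come from the disjointness of these sets.\<close>

definition chain_areas :: "(nat \<Rightarrow> (real^2) set) \<Rightarrow> nat \<Rightarrow> nat \<Rightarrow> real^2 \<Rightarrow> real^2 \<Rightarrow> (nat \<Rightarrow> real) set" where
  "chain_areas A k m x y = areas m k ` {p. p m = x \<and> p (m + 1) = y \<and> (\<forall>i\<in>{m..k}. p (i + 2) \<in> A i)}"

lemma areas_cong: "(\<And>i. i \<in> {m..k + 2} \<Longrightarrow> p i = p' i) \<Longrightarrow> areas m k p = areas m k p'"
  unfolding areas_def by (rule restrict_ext) auto

lemma sets_chain_areas:
  assumes "\<And>i. i \<in> {m..k} \<Longrightarrow> compact (A i)"
  shows "chain_areas A k m x y \<in> sets (Pi\<^sub>M {m..k} (\<lambda>_. lborel))"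
proof -
  define D where "D i = (if i = m then {x} else if i = m + 1 then {y}
    else if i \<in> {m + 2..k + 2} then A (i - 2) else {0})" for i
  have "compact (A (i - 2))" if "i \<in> {m + 2..k + 2}" for i by (rule assms) (use that in auto)
  then have D: "compact (D i)" for i by (auto simp: D_def)
  have "chain_areas A k m x y = areas m k ` {p. \<forall>i. p i \<in> D i}"
  proof (intro equalityI subsetI)
    fix t assume "t \<in> chain_areas A k m x y"
    then obtain p where p: "t = areas m k p" "p m = x" "p (m + 1) = y" "\<And>i. i \<in> {m..k} \<Longrightarrow> p (i + 2) \<in> A i"
      unfolding chain_areas_def by auto
    define p' where "p' i = (if i \<in> {m..k + 2} \<or> i = m \<or> i = m + 1 then p i else 0)" for i
    have "p' i \<in> D i" for i
    proof (cases "i \<in> {m + 2..k + 2}")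
      case True
      then obtain l where "i = l + 2" "l \<in> {m..k}" by (intro that[of "i - 2"]) auto
      then show ?thesis using p(4)[of l] by (auto simp: D_def p'_def)
    next
      case False
      then show ?thesis using p(2,3) by (auto simp: D_def p'_def)
    qed
    moreover have "t = areas m k p'" unfolding p(1) by (rule areas_cong) (simp add: p'_def)
    ultimately show "t \<in> areas m k ` {p. \<forall>i. p i \<in> D i}" by blast
  next
    fix t assume "t \<in> areas m k ` {p. \<forall>i. p i \<in> D i}"
    then obtain p where p: "t = areas m k p" "\<And>i. p i \<in> D i" by auto
    have "p (i + 2) \<in> A i" if "i \<in> {m..k}" for i
      using p(2)[of "i + 2"] that by (auto simp: D_def split: if_splits)
    moreover have "p m = x" "p (m + 1) = y" using p(2)[of m] p(2)[of "m + 1"] by (auto simp: D_def)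
    ultimately show "t \<in> chain_areas A k m x y" unfolding chain_areas_def p(1) by blast
  qed
  then show ?thesis using sets_areas_image[OF compact_Pi_UNIV[OF D]] by simp
qed

text \<open>Injectivity is not a closed condition, so the admissible chains are exhausted by compact
  sets on which distinct vertices are at least \<open>1 / (n + 1)\<close> apart.\<close>

lemma sets_edge_chain_areas:
  assumes "compact E"
  shows "edge_chain_areas k E x1 x2 \<in> sets (Pi\<^sub>M {1..k} (\<lambda>_. lborel))"
proof -
  define D where "D i = (if i = 1 then {x1} else if i = 2 then {x2}
    else if i \<in> {3..k + 2} then E else {0})" for i :: nat
  have D: "compact (D i)" for i using assms by (auto simp: D_def)
  define Q where "Q = {ij \<in> {3..k + 2} \<times> {3..k + 2}. fst ij \<noteq> snd ij}"
  define S where "S n = {p. \<forall>i. p i \<in> D i} \<inter>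
    (\<Inter>ij\<in>Q. {p. inverse (real (Suc n)) \<le> dist (p (fst ij)) (p (snd ij))})" for n
  have "compact (S n)" for n
    unfolding S_def
    by (intro compact_Int_closed compact_Pi_UNIV D closed_INT ballI closed_Collect_le
        continuous_intros continuous_on_product_coordinates)
  then have meas: "(\<Union>n. areas 1 k ` S n) \<in> sets (Pi\<^sub>M {1..k} (\<lambda>_. lborel))"
    by (intro sets.countable_UN') (auto intro: sets_areas_image)
  have "edge_chain_areas k E x1 x2 = (\<Union>n. areas 1 k ` S n)"
  proof (intro equalityI subsetI)
    fix t assume "t \<in> edge_chain_areas k E x1 x2"
    then obtain p where p: "t = areas 1 k p" "p 1 = x1" "p 2 = x2"
      "\<And>i. i \<in> {3..k + 2} \<Longrightarrow> p i \<in> E" "inj_on p {3..k + 2}"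
      unfolding edge_chain_areas_def areas_def by blast
    define p' where "p' i = (if i \<in> {1..k + 2} \<or> i = 2 then p i else 0)" for i
    have p'D: "p' i \<in> D i" for i using p(2,3,4) by (auto simp: D_def p'_def)
    have "\<exists>n. \<forall>ij\<in>Q. inverse (real (Suc n)) \<le> dist (p' (fst ij)) (p' (snd ij))"
    proof (cases "Q = {}")
      case False
      let ?m = "Min ((\<lambda>ij. dist (p' (fst ij)) (p' (snd ij))) ` Q)"
      have fin: "finite Q" unfolding Q_def by (rule finite_subset[of _ "{3..k + 2} \<times> {3..k + 2}"]) auto
      have "?m > 0"
      proof (subst Min_gr_iff)
        show "\<forall>a\<in>(\<lambda>ij. dist (p' (fst ij)) (p' (snd ij))) ` Q. 0 < a"
          using p(5) by (auto simp: p'_def inj_on_def Q_def)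
      qed (use fin False in auto)
      then obtain n where "inverse (real (Suc n)) < ?m" using reals_Archimedean by blast
      moreover have "?m \<le> dist (p' (fst ij)) (p' (snd ij))" if "ij \<in> Q" for ij
        using fin that by (intro Min_le) auto
      ultimately show ?thesis by (meson less_le_trans less_imp_le)
    qed auto
    then obtain n where "p' \<in> S n" using p'D unfolding S_def by blast
    moreover have "t = areas 1 k p'" unfolding p(1) by (rule areas_cong) (simp add: p'_def)
    ultimately show "t \<in> (\<Union>n. areas 1 k ` S n)" by blast
  next
    fix t assume "t \<in> (\<Union>n. areas 1 k ` S n)"
    then obtain n p where t: "t = areas 1 k p" and p: "p \<in> S n" by auto
    have pD: "p i \<in> D i" for i using p by (simp add: S_def)
    have "p 1 = x1" "p 2 = x2" using pD[of 1] pD[of 2] by (simp_all add: D_def)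
    moreover have "\<forall>i\<in>{3..k + 2}. p i \<in> E"
    proof
      fix i assume "i \<in> {3..k + 2}"
      then show "p i \<in> E" using pD[of i] by (simp add: D_def)
    qed
    moreover have "inj_on p {3..k + 2}"
    proof (rule inj_onI, rule ccontr)
      fix i j assume "i \<in> {3..k + 2}" "j \<in> {3..k + 2}" "p i = p j" "i \<noteq> j"
      then have "(i, j) \<in> Q" by (simp add: Q_def)
      then have "inverse (real (Suc n)) \<le> dist (p i) (p j)" using p unfolding S_def by fastforce
      then have "inverse (real (Suc n)) \<le> 0" using \<open>p i = p j\<close> by simp
      then show False by simp
    qed
    ultimately show "t \<in> edge_chain_areas k E x1 x2"
      unfolding edge_chain_areas_def t areas_def by blast
  qed
  then show ?thesis using meas by simp
qed

section \<open>Positive measure for chains, and disjoint compact sets to draw them from\<close>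

context frostman_measure
begin

text \<open>Backward induction on \<open>m\<close>. The slice of the chain set over a first area
  \<open>triangle_area x y z\<close> contains the chain set starting from \<open>y, z\<close>, which
  is positive for almost all \<open>z\<close>. The areas from such \<open>z\<close> fill a set of
  positive length, so Fubini's theorem applies.\<close>

lemma AE_chain_areas_pos:
  assumes A: "\<And>i. i \<in> {1..k} \<Longrightarrow> compact (A i) \<and> emeasure \<mu> (A i) > 0"
    and m: "1 \<le> m" "m \<le> k + 1"
  shows "AE x in \<mu>. AE y in \<mu>. emeasure (Pi\<^sub>M {m..k} (\<lambda>_. lborel)) (chain_areas A k m x y) > 0"
  using m(2,1)
proof (induction m rule: inc_induct)
  case base
  \<comment> \<open>The empty product is a one-point space of measure 1, and the empty chain yields
    its point.\<close>
  have "chain_areas A k (k + 1) x y = {\<lambda>_. undefined}" for x y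
  proof -
    have const: "areas (k + 1) k = (\<lambda>_ _. undefined)" by (auto simp: areas_def fun_eq_iff)
    have "(\<lambda>i. if i = k + 1 then x else y) \<in>
        {p. p (k + 1) = x \<and> p (k + 1 + 1) = y \<and> (\<forall>i\<in>{k + 1..k}. p (i + 2) \<in> A i)}" by auto
    then show ?thesis unfolding chain_areas_def const by (rule image_constant)
  qed
  then show ?case by simp
next
  case (step m)
  then have m: "m \<in> {1..k}" by auto
  let ?P = "\<lambda>m. Pi\<^sub>M {m..k} (\<lambda>_. lborel :: real measure)"
  interpret product_sigma_finite "\<lambda>_. lborel :: real measure" ..
  interpret P: sigma_finite_measure "?P (Suc m)" by (rule sigma_finite) simp
  have insert: "{m..k} = insert m {Suc m..k}" using m by auto
  have meas: "chain_areas A k l x y \<in> sets (?P l)" if "l \<ge> m" for l x y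
    by (rule sets_chain_areas) (use A that m in auto)
  have pos: "emeasure (?P m) (chain_areas A k m x y) > 0"
    if xy: "x $ 2 \<noteq> y $ 2" "proj_energy (slope (x - y)) < \<infinity>"
      and y: "AE z in \<mu>. emeasure (?P (Suc m)) (chain_areas A k (Suc m) y z) > 0" for x y
  proof (rule ccontr)
    let ?C = "chain_areas A k m x y"
    assume "\<not> emeasure (?P m) ?C > 0"
    then have null: "emeasure (?P m) ?C = 0" by simp
    obtain N where N: "{z \<in> space \<mu>. \<not> emeasure (?P (Suc m)) (chain_areas A k (Suc m) y z) > 0} \<subseteq> N"
      "emeasure \<mu> N = 0" "N \<in> sets \<mu>"
      using y by (rule AE_E)
    have Am: "A m \<in> sets \<mu>" using A[OF m] sets_\<mu> by (auto intro: borel_closed compact_imp_closed)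
    have "emeasure \<mu> (A m - N) = emeasure \<mu> (A m)"
      using N Am by (intro emeasure_Diff_null_set) (auto intro: null_setsI)
    then have "0 < emeasure \<mu> (A m - N)" using A[OF m] by simp
    \<comment> \<open>Inner regularity yields a compact set of third vertices, all with good
      continuations, as the projection argument needs compactness.\<close>
    also have "emeasure \<mu> (A m - N) = (SUP B \<in> {B. B \<subseteq> A m - N \<and> compact B}. emeasure \<mu> B)"
      using N Am emeasure_finite by (intro inner_regular sets_\<mu>) (auto simp: sets_\<mu>)
    finally obtain B where B: "B \<subseteq> A m - N" "compact B" "emeasure \<mu> B > 0"
      by (auto simp: less_SUP_iff)
    have "0 < emeasure lborel (triangle_area x y ` B)"
      by (rule emeasure_triangle_areas_pos[OF xy B(2,3)])
    let ?f = "\<lambda>t. \<integral>\<^sup>+\<tau>. indicator ?C (\<tau>(m := t)) \<partial>?P (Suc m)"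
    have C [measurable]: "?C \<in> sets (Pi\<^sub>M (insert m {Suc m..k}) (\<lambda>_. lborel))"
      using meas[of m x y] unfolding insert by simp
    have f_pos: "?f t > 0" if "t \<in> triangle_area x y ` B" for t
    proof -
      obtain z where z: "z \<in> B" "t = triangle_area x y z" using \<open>t \<in> triangle_area x y ` B\<close> by auto
      have "0 < emeasure (?P (Suc m)) (chain_areas A k (Suc m) y z)" using z(1) B(1) N(1) by auto
      also have "\<dots> = (\<integral>\<^sup>+\<tau>. indicator (chain_areas A k (Suc m) y z) \<tau> \<partial>?P (Suc m))"
        by (rule nn_integral_indicator[symmetric]) (simp add: meas)
      also have "\<dots> \<le> ?f t"
      proof (rule nn_integral_mono)
        fix \<tau>
        have "\<tau>(m := t) \<in> ?C" if \<tau>: "\<tau> \<in> chain_areas A k (Suc m) y z"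
        proof -
          obtain p where p: "\<tau> = areas (Suc m) k p" "p (Suc m) = y" "p (Suc m + 1) = z"
            "\<And>i. i \<in> {Suc m..k} \<Longrightarrow> p (i + 2) \<in> A i"
            using \<tau> unfolding chain_areas_def by auto
          \<comment> \<open>Prepending \<open>x\<close> to the shorter chain adds the first area
            \<open>t\<close> and leaves all later triangles unchanged.\<close>
          have "\<tau>(m := t) = areas m k (p(m := x))"
            using m p(2,3) unfolding p(1) z(2) areas_def by (auto simp: fun_eq_iff)
          moreover have "(p(m := x)) (i + 2) \<in> A i" if "i \<in> {m..k}" for i
            using that p(3) p(4)[of i] z(1) B(1) by (cases "i = m") auto
          ultimately show ?thesis unfolding chain_areas_def using p(2) by (intro image_eqI) auto
        qed
        then show "indicator (chain_areas A k (Suc m) y z) \<tau> \<le> (indicator ?C (\<tau>(m := t)) :: ennreal)"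
          by (auto simp: indicator_def)
      qed
      finally show ?thesis .
    qed
    have [measurable]: "(\<lambda>(t, \<tau>). indicator ?C (\<tau>(m := t)) :: ennreal) \<in> borel_measurable (lborel \<Otimes>\<^sub>M ?P (Suc m))"
      by measurable
    have "(\<integral>\<^sup>+t. ?f t \<partial>lborel) = (\<integral>\<^sup>+\<tau>. indicator ?C \<tau> \<partial>Pi\<^sub>M (insert m {Suc m..k}) (\<lambda>_. lborel))"
      by (rule product_nn_integral_insert_rev[symmetric]) auto
    also have "\<dots> = 0" using null C unfolding insert by simp
    finally have "AE t in lborel. ?f t = 0"
      by (subst (asm) nn_integral_0_iff_AE) auto
    then have "AE t in lborel. t \<notin> triangle_area x y ` B"
      by eventually_elim (use f_pos in force)
    moreover have "compact (triangle_area x y ` B)"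
      using B(2) by (intro compact_continuous_image continuous_intros)
    ultimately have "emeasure lborel (triangle_area x y ` B) = 0"
      by (subst (asm) AE_iff_measurable[where N = "triangle_area x y ` B"])
        (auto intro: borel_closed compact_imp_closed)
    then show False using \<open>0 < emeasure lborel (triangle_area x y ` B)\<close> by simp
  qed
  have IH: "AE y in \<mu>. AE z in \<mu>. emeasure (?P (Suc m)) (chain_areas A k (Suc m) y z) > 0"
    by (rule step.IH) simp
  show ?case using AE_pair_slope_finite
  proof eventually_elim
    case (elim x)
    from elim IH show ?case by eventually_elim (use pos in blast)
  qed
qed

text \<open>Balls of a small enough fixed radius have less mass than \<open>X\<close>, so none
  exhausts it. Countably many of them cover the plane, so one meets \<open>X\<close> in positive
  mass.\<close>

lemma positive_set_split:
  assumes X: "X \<in> sets \<mu>" "emeasure \<mu> X > 0"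
  obtains Y where "Y \<in> sets \<mu>" "emeasure \<mu> (X \<inter> Y) > 0" "emeasure \<mu> (X - Y) > 0"
proof -
  have pos: "measure \<mu> X > 0" using X by (simp add: emeasure_eq_measure)
  have "(\<lambda>j. K * q ^ j) \<longlonglongrightarrow> 0"
    using q by (intro tendsto_mult_right_zero LIMSEQ_power_zero) auto
  then have "eventually (\<lambda>j. K * q ^ j < measure \<mu> X) sequentially"
    using pos by (rule order_tendstoD)
  then obtain j where j: "K * q ^ j < measure \<mu> X" by (auto simp: eventually_sequentially)
  obtain D :: "(real^2) set" where D: "countable D" "\<And>U. open U \<Longrightarrow> U \<noteq> {} \<Longrightarrow> \<exists>d\<in>D. d \<in> U"
    by (rule countable_dense_setE) blast
  let ?B = "\<lambda>d. cball d ((1/2) ^ j)"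
  have "\<exists>d\<in>D. emeasure \<mu> (X \<inter> ?B d) > 0"
  proof (rule ccontr)
    assume "\<not> ?thesis"
    then have "(\<Union>d\<in>D. X \<inter> ?B d) \<in> null_sets \<mu>"
      using D(1) X by (intro null_sets_UN') (auto simp: null_sets_def sets_\<mu>)
    moreover have "X \<subseteq> (\<Union>d\<in>D. X \<inter> ?B d)"
    proof
      fix x assume "x \<in> X"
      have "ball x ((1/2) ^ j) \<noteq> {}" by (simp add: not_le)
      from D(2)[OF open_ball this] obtain d where "d \<in> D" "d \<in> ball x ((1/2) ^ j)" by blast
      then have "x \<in> ?B d" by (simp add: dist_commute)
      then show "x \<in> (\<Union>d\<in>D. X \<inter> ?B d)" using \<open>x \<in> X\<close> \<open>d \<in> D\<close> by blast
    qed
    ultimately have "emeasure \<mu> X = 0" by (metis emeasure_eq_0 null_setsD1 null_setsD2)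
    then show False using X by simp
  qed
  then obtain d where d: "emeasure \<mu> (X \<inter> ?B d) > 0" by auto
  have "measure \<mu> X \<le> measure \<mu> (X - ?B d) + measure \<mu> (?B d)"
  proof -
    have "measure \<mu> X \<le> measure \<mu> ((X - ?B d) \<union> ?B d)"
      using X by (intro finite_measure_mono) (auto simp: sets_\<mu>)
    also have "\<dots> \<le> measure \<mu> (X - ?B d) + measure \<mu> (?B d)"
      using X by (intro measure_Un_le) (auto simp: sets_\<mu>)
    finally show ?thesis .
  qed
  then have "measure \<mu> (X - ?B d) > 0" using measure_cball[of d j] j by linarith
  then show ?thesis using d by (intro that[of "?B d"]) (auto simp: sets_\<mu> emeasure_eq_measure)
qed

lemma disjoint_positive_sets:
  assumes "X \<in> sets \<mu>" "emeasure \<mu> X > 0"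
  shows "\<exists>A :: nat \<Rightarrow> (real^2) set. disjoint_family_on A {..<n} \<and>
    (\<forall>i<n. A i \<in> sets \<mu> \<and> A i \<subseteq> X \<and> emeasure \<mu> (A i) > 0)"
  using assms
proof (induction n arbitrary: X)
  case 0
  then show ?case by (simp add: disjoint_family_on_def)
next
  case (Suc n)
  obtain Y where Y: "Y \<in> sets \<mu>" "emeasure \<mu> (X \<inter> Y) > 0" "emeasure \<mu> (X - Y) > 0"
    using positive_set_split[OF Suc.prems] by blast
  obtain A :: "nat \<Rightarrow> (real^2) set" where A: "disjoint_family_on A {..<n}"
    "\<And>i. i < n \<Longrightarrow> A i \<in> sets \<mu> \<and> A i \<subseteq> X - Y \<and> emeasure \<mu> (A i) > 0"
    using Suc.IH[of "X - Y"] Y Suc.prems by auto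
  let ?A = "A(n := X \<inter> Y)"
  have "disjoint_family_on ?A {..<Suc n}"
    unfolding disjoint_family_on_def
  proof (intro ballI impI)
    fix i j assume "i \<in> {..<Suc n}" "j \<in> {..<Suc n}" "i \<noteq> j"
    then consider "i < n" "j < n" | "i = n" "j < n" | "i < n" "j = n" by fastforce
    then show "?A i \<inter> ?A j = {}"
      using A(1) A(2)[of i] A(2)[of j] \<open>i \<noteq> j\<close> by cases (auto simp: disjoint_family_on_def)
  qed
  moreover have "?A i \<in> sets \<mu> \<and> ?A i \<subseteq> X \<and> emeasure \<mu> (?A i) > 0" if "i < Suc n" for i
    using A(2)[of i] that Y Suc.prems by (auto simp: less_Suc_eq)
  ultimately show ?case by blast
qed

lemma disjoint_positive_compact_sets:
  assumes "X \<in> sets \<mu>" "emeasure \<mu> X > 0"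
  obtains A :: "nat \<Rightarrow> (real^2) set" where "disjoint_family_on A {..<n}"
    "\<And>i. i < n \<Longrightarrow> compact (A i) \<and> A i \<subseteq> X \<and> emeasure \<mu> (A i) > 0"
proof -
  obtain A :: "nat \<Rightarrow> (real^2) set" where A: "disjoint_family_on A {..<n}"
    "\<And>i. i < n \<Longrightarrow> A i \<in> sets \<mu> \<and> A i \<subseteq> X \<and> emeasure \<mu> (A i) > 0"
    using disjoint_positive_sets[OF assms, of n] by blast
  have "\<exists>B. B \<subseteq> A i \<and> compact B \<and> emeasure \<mu> B > 0" if i: "i < n" for i
  proof -
    have "emeasure \<mu> (A i) = (SUP B \<in> {B. B \<subseteq> A i \<and> compact B}. emeasure \<mu> B)"
      using A(2)[OF i] emeasure_finite by (intro inner_regular sets_\<mu>) (auto simp: sets_\<mu>)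
    then have "0 < (SUP B \<in> {B. B \<subseteq> A i \<and> compact B}. emeasure \<mu> B)" using A(2)[OF i] by metis
    then show ?thesis unfolding less_SUP_iff by blast
  qed
  then obtain B where B: "\<And>i. i < n \<Longrightarrow> B i \<subseteq> A i \<and> compact (B i) \<and> emeasure \<mu> (B i) > 0" by metis
  show ?thesis
  proof (rule that[of B])
    show "disjoint_family_on B {..<n}"
      using A(1) B unfolding disjoint_family_on_def by blast
    show "compact (B i) \<and> B i \<subseteq> X \<and> emeasure \<mu> (B i) > 0" if "i < n" for i
      using A(2)[OF that] B[OF that] by blast
  qed
qed

end

lemma chain_areas_subset_edge_chain_areas:
  assumes "disjoint_family_on A {..<k + 1}" "\<And>i. i < k + 1 \<Longrightarrow> A i \<subseteq> E"
  shows "chain_areas A k 1 x y \<subseteq> edge_chain_areas k E x y"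
proof
  fix t assume "t \<in> chain_areas A k 1 x y"
  then obtain p where p: "t = areas 1 k p" "p 1 = x" "p 2 = y" "\<And>i. i \<in> {1..k} \<Longrightarrow> p (i + 2) \<in> A i"
    unfolding chain_areas_def by (auto simp: numeral_2_eq_2)
  have pA: "p i \<in> A (i - 2)" "i - 2 < k + 1" if "i \<in> {3..k + 2}" for i
  proof -
    obtain l where "i = l + 2" "l \<in> {1..k}" by (rule that[of "i - 2"]) (use \<open>i \<in> {3..k + 2}\<close> in auto)
    then show "p i \<in> A (i - 2)" "i - 2 < k + 1" using p(4)[of l] by auto
  qed
  have "inj_on p {3..k + 2}"
  proof (rule inj_onI, rule ccontr)
    fix i j assume ij: "i \<in> {3..k + 2}" "j \<in> {3..k + 2}" "p i = p j" "i \<noteq> j"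
    then have "i - 2 \<noteq> j - 2" by auto
    then have "A (i - 2) \<inter> A (j - 2) = {}"
      using assms(1) pA(2)[OF ij(1)] pA(2)[OF ij(2)] unfolding disjoint_family_on_def by simp
    then show False using pA(1)[OF ij(1)] pA(1)[OF ij(2)] ij(3) by auto
  qed
  moreover have "\<forall>i\<in>{3..k + 2}. p i \<in> E" using pA assms(2) by blast
  ultimately show "t \<in> edge_chain_areas k E x y"
    unfolding edge_chain_areas_def p(1) areas_def using p(2,3) by blast
qed

theorem theorem1p6:
  fixes k :: nat and E :: "(real^2) set"
  assumes "k \<ge> 1" and "compact E" and "hausdorff_dim E > 1"
  shows "\<exists>x1\<in>E. \<exists>x2\<in>E. x1 \<noteq> x2 \<and> emeasure (lebesgue_pow k) (edge_chain_areas k E x1 x2) > 0"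
proof -
  obtain \<mu> :: "(real^2) measure" and K q :: real where \<mu>:
    "sets \<mu> = sets borel" "finite_measure \<mu>" "emeasure \<mu> (- E) = 0" "emeasure \<mu> UNIV > 0"
    "0 \<le> q" "q < 1/2" "0 \<le> K" "\<And>x j. measure \<mu> (cball x ((1/2) ^ j)) \<le> K * q ^ j"
    using frostman_planar[OF assms(2,3)] by metis
  interpret frostman_measure \<mu> K q
    using \<mu> by (intro frostman_measure.intro frostman_measure_axioms.intro)
  have E: "E \<in> sets \<mu>" "- E \<in> sets \<mu>"
    using compact_imp_closed[OF assms(2)] by (auto simp: \<mu>(1) open_Compl)
  have "emeasure \<mu> UNIV \<le> emeasure \<mu> E + emeasure \<mu> (- E)"
    using emeasure_subadditive[OF E] by simp
  then have "emeasure \<mu> E > 0" using \<mu>(3,4) by simp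
  \<comment> \<open>The chain uses the labels \<open>1..k\<close>, hence a family indexed below
    \<open>k + 1\<close>.\<close>
  then obtain A :: "nat \<Rightarrow> (real^2) set" where A: "disjoint_family_on A {..<k + 1}"
    "\<And>i. i < k + 1 \<Longrightarrow> compact (A i) \<and> A i \<subseteq> E \<and> emeasure \<mu> (A i) > 0"
    using disjoint_positive_compact_sets[OF E(1), of "k + 1"] by blast
  let ?P = "Pi\<^sub>M {1..k} (\<lambda>_. lborel :: real measure)"
  have chains: "AE x in \<mu>. AE y in \<mu>. emeasure ?P (chain_areas A k 1 x y) > 0"
    by (rule AE_chain_areas_pos) (use A(2) in auto)
  have "AE x in \<mu>. x \<notin> - E" by (rule AE_not_in) (use E \<mu>(3) in auto)
  then have AE_E: "AE x in \<mu>. x \<in> E" by simp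
  \<comment> \<open>For a nonzero measure, almost-everywhere statements have witnesses; this
    produces first \<open>x\<close> and then \<open>y\<close>.\<close>
  have nontrivial: "ae_filter \<mu> \<noteq> bot" using \<mu>(4) by (simp add: ae_filter_eq_bot_iff)
  have "AE x in \<mu>. x \<in> E \<and> (AE y in \<mu>. y \<in> E \<and> x \<noteq> y \<and> emeasure ?P (chain_areas A k 1 x y) > 0)"
    using AE_E chains AE_pair_slope_finite
  proof eventually_elim
    case (elim x)
    \<comment> \<open>The points are distinct because almost surely their heights differ.\<close>
    have "AE y in \<mu>. y \<in> E \<and> x \<noteq> y \<and> emeasure ?P (chain_areas A k 1 x y) > 0"
      using AE_E elim(2,3) by eventually_elim auto
    then show ?case using elim(1) by simp
  qed
  then obtain x where x: "x \<in> E" "AE y in \<mu>. y \<in> E \<and> x \<noteq> y \<and> emeasure ?P (chain_areas A k 1 x y) > 0"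
    using eventually_happens'[OF nontrivial] by blast
  obtain y where y: "y \<in> E" "x \<noteq> y" "emeasure ?P (chain_areas A k 1 x y) > 0"
    using eventually_happens'[OF nontrivial x(2)] by blast
  \<comment> \<open>Measurability of the larger set is needed for monotonicity and for passing to
    the completed measure.\<close>
  have sets: "edge_chain_areas k E x y \<in> sets ?P" by (rule sets_edge_chain_areas[OF assms(2)])
  have "emeasure ?P (chain_areas A k 1 x y) \<le> emeasure ?P (edge_chain_areas k E x y)"
    using A by (intro emeasure_mono sets chain_areas_subset_edge_chain_areas) auto
  then have "emeasure (lebesgue_pow k) (edge_chain_areas k E x y) > 0"
    using y(3) sets by (simp add: lebesgue_pow_def emeasure_completion)
  then show ?thesis using x(1) y(1,2) by blast
qed

end
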